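(* Let $C$ be a generic genus three curve $y^2=\sum_{i=0}^{8}\binom{8}{i}a_ix^i$ with covariant Kleinian $\wp$-functions and symmetric $5\times5$ matrix $h$ as in the context. Define the antisymmetric $5\times5$ matrix $$A=\begin{pmatrix}0&-\wp_{333}&\wp_{233}&-\wp_{223}+\wp_{133}&\wp_{222}-2\wp_{123}\\ \wp_{333}&0&-\wp_{133}&\wp_{123}&-\wp_{122}+\wp_{113}\\ -\wp_{233}&\wp_{133}&0&-\wp_{113}&\wp_{112}\\ \wp_{223}-\wp_{133}&-\wp_{123}&\wp_{113}&0&-\wp_{111}\\ -\wp_{222}+2\wp_{123}&\wp_{122}-\wp_{113}&-\wp_{112}&\wp_{111}&0\end{pmatrix}.$$ Then $hA=0$.
   Context: Genus three setting: $a_0,\dots,a_8\in\mathbb{C}$ generic. Holomorphic differentials $du_k=x^{k-1}dx/y$ ($k=1,2,3$), coordinates $u=(u_1,u_2,u_3)$ on the Jacobian. The covariant $\wp$-functions $\wp_{ij}=\wp_{ji}$ are meromorphic functions of $u$ defined by requiring that for points $(x,y),(x_1,y_1),(x_2,y_2),(x_3,y_3)$ on $C$, with the $\wp_{ij}$ evaluated at $u=\int^{(x,y)}d\mathbf{u}+\sum_{k=1}^3\int^{(x_k,y_k)}d\mathbf{u}$, one has for $i=1,2,3$: $yy_i-\mathbf{x}h\mathbf{x}_i^T=0$, where $\mathbf{x}=(1,x,\dots,x^4)$, $\mathbf{x}_i=(1,x_i,\dots,x_i^4)$ and $$h=\begin{pmatrix}a_0&4a_1&6a_2-2\wp_{11}&4a_3-2\wp_{12}&a_4-2\wp_{13}\\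 4a_1&16a_2+4\wp_{11}&24a_3+2\wp_{12}&16a_4-2\wp_{22}+4\wp_{13}&4a_5-2\wp_{23}\\ 6a_2-2\wp_{11}&24a_3+2\wp_{12}&36a_4+4\wp_{22}-4\wp_{13}&24a_5+2\wp_{23}&6a_6-2\wp_{33}\\ 4a_3-2\wp_{12}&16a_4-2\wp_{22}+4\wp_{13}&24a_5+2\wp_{23}&16a_6+4\wp_{33}&4a_7\\ a_4-2\wp_{13}&4a_5-2\wp_{23}&6a_6-2\wp_{33}&4a_7&a_8\end{pmatrix}.$$ $\wp_{ijk}=\partial\wp_{ij}/\partial u_k$. *)

theory Defs
  imports "HOL-Analysis.Analysis"
begin

type_synonym cvec3 = "complex \<times> complex \<times> complex"

definition fC :: "(nat \<Rightarrow> complex) \<Rightarrow> complex \<Rightarrow> complex" where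
  "fC a x = (\<Sum>i\<le>8. of_nat (8 choose i) * a i * x ^ i)"

definition fC' :: "(nat \<Rightarrow> complex) \<Rightarrow> complex \<Rightarrow> complex" where
  "fC' a x = (\<Sum>i\<in>{1..8}. of_nat (8 choose i) * a i * of_nat i * x ^ (i - 1))"

definition add3 :: "cvec3 \<Rightarrow> cvec3 \<Rightarrow> cvec3" where
  "add3 u v = (fst u + fst v, fst (snd u) + fst (snd v), snd (snd u) + snd (snd v))"

definition upd3 :: "nat \<Rightarrow> complex \<Rightarrow> cvec3 \<Rightarrow> cvec3" where
  "upd3 k t u = (if k = 1 then add3 u (t, 0, 0) else if k = 2 then add3 u (0, t, 0)
                 else add3 u (0, 0, t))"

definition pderiv3 :: "(cvec3 \<Rightarrow> complex) \<Rightarrow> nat \<Rightarrow> cvec3 \<Rightarrow> complex" where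
  "pderiv3 F k u = deriv (\<lambda>t. F (upd3 k t u)) 0"

text \<open>Holomorphy on an open set of C^3: continuous and holomorphic in each variable
  separately (equivalent to joint holomorphy by Osgood's lemma).\<close>
definition holo3 :: "(cvec3 \<Rightarrow> complex) \<Rightarrow> cvec3 set \<Rightarrow> bool" where
  "holo3 F D \<longleftrightarrow> continuous_on D F \<and>
     (\<forall>u\<in>D. \<forall>k\<in>{1,2,3}. (\<lambda>t. F (upd3 k t u)) field_differentiable (at 0))"

definition curve_path ::
  "(nat \<Rightarrow> complex) \<Rightarrow> (real \<Rightarrow> complex) \<Rightarrow> (real \<Rightarrow> complex) \<Rightarrow>
     complex \<times> complex \<Rightarrow> complex \<times> complex \<Rightarrow> bool" where
  "curve_path a gx gy P Q \<longleftrightarrow> valid_path gx \<and> continuous_on {0..1} gy \<and>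
     (\<forall>t\<in>{0..1}. (gy t)\<^sup>2 = fC a (gx t) \<and> gy t \<noteq> 0) \<and>
     (gx 0, gy 0) = P \<and> (gx 1, gy 1) = Q"

definition abel_int :: "(real \<Rightarrow> complex) \<Rightarrow> (real \<Rightarrow> complex) \<Rightarrow> nat \<Rightarrow> complex" where
  "abel_int gx gy k = integral {0..1} (\<lambda>t. vector_derivative gx (at t) * gx t ^ (k - 1) / gy t)"

definition abel :: "(real \<Rightarrow> complex) \<Rightarrow> (real \<Rightarrow> complex) \<Rightarrow> cvec3" where
  "abel gx gy = (abel_int gx gy 1, abel_int gx gy 2, abel_int gx gy 3)"

text \<open>The matrix h (indices 0..4), in terms of a and the values p i j = wp_ij.\<close>
definition hmat :: "(nat \<Rightarrow> complex) \<Rightarrow> (nat \<Rightarrow> nat \<Rightarrow> complex) \<Rightarrow> nat \<Rightarrow> nat \<Rightarrow> complex" where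
  "hmat a p i j =
    [[a 0, 4 * a 1, 6 * a 2 - 2 * p 1 1, 4 * a 3 - 2 * p 1 2, a 4 - 2 * p 1 3],
     [4 * a 1, 16 * a 2 + 4 * p 1 1, 24 * a 3 + 2 * p 1 2, 16 * a 4 - 2 * p 2 2 + 4 * p 1 3, 4 * a 5 - 2 * p 2 3],
     [6 * a 2 - 2 * p 1 1, 24 * a 3 + 2 * p 1 2, 36 * a 4 + 4 * p 2 2 - 4 * p 1 3, 24 * a 5 + 2 * p 2 3, 6 * a 6 - 2 * p 3 3],
     [4 * a 3 - 2 * p 1 2, 16 * a 4 - 2 * p 2 2 + 4 * p 1 3, 24 * a 5 + 2 * p 2 3, 16 * a 6 + 4 * p 3 3, 4 * a 7],
     [a 4 - 2 * p 1 3, 4 * a 5 - 2 * p 2 3, 6 * a 6 - 2 * p 3 3, 4 * a 7, a 8]] ! i ! j"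

text \<open>The antisymmetric matrix A (indices 0..4), q i j k = wp_ijk.\<close>
definition Amat :: "(nat \<Rightarrow> nat \<Rightarrow> nat \<Rightarrow> complex) \<Rightarrow> nat \<Rightarrow> nat \<Rightarrow> complex" where
  "Amat q i j =
    [[0, - q 3 3 3, q 2 3 3, - q 2 2 3 + q 1 3 3, q 2 2 2 - 2 * q 1 2 3],
     [q 3 3 3, 0, - q 1 3 3, q 1 2 3, - q 1 2 2 + q 1 1 3],
     [- q 2 3 3, q 1 3 3, 0, - q 1 1 3, q 1 1 2],
     [q 2 2 3 - q 1 3 3, - q 1 2 3, q 1 1 3, 0, - q 1 1 1],
     [- q 2 2 2 + 2 * q 1 2 3, q 1 2 2 - q 1 1 3, - q 1 1 2, q 1 1 1, 0]] ! i ! j"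

definition hform :: "(nat \<Rightarrow> nat \<Rightarrow> complex) \<Rightarrow> complex \<Rightarrow> complex \<Rightarrow> complex" where
  "hform H x x' = (\<Sum>i<5. \<Sum>j<5. x ^ i * H i j * x' ^ j)"

end

theory Submission
  imports Defs "HOL-Complex_Analysis.Complex_Analysis" "HOL-Computational_Algebra.Fundamental_Theorem_Algebra"
begin

text \<open>
  Four points \<open>(x\<^sub>i, y\<^sub>i)\<close> with distinct abscissae give a factorization \<open>f = L\<^sup>2 + K W\<close> into quartics, with
  \<open>W = \<Prod>(x - x\<^sub>i)\<close> and \<open>L(x\<^sub>i) = y\<^sub>i\<close>. The relations \<open>y\<^sub>i y\<^sub>j = h(x\<^sub>i, x\<^sub>j)\<close> force
  \<open>h = L L\<^sup>T + (K W\<^sup>T + W K\<^sup>T) / 2\<close>. Moving one point at a time and differentiating these relations, the third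
  derivatives turn out to be, up to a constant, the \<open>3 \<times> 3\<close> minors of the matrix with rows \<open>L, K, W\<close> expanded in
  Schur functions; hence \<open>A\<close> is a multiple of the Hodge dual of \<open>L \<and> K \<and> W\<close> and is annihilated by \<open>h\<close>.

  This gives \<open>h A = 0\<close> at the points \<open>u\<close> that are sums of four Abelian integrals, and one needs that these are
  dense in \<open>\<complex>\<^sup>3\<close>, a weak form of Jacobi inversion. The roots of \<open>M\<^sub>s = s\<^sup>2 K + 2 s L - W\<close> with ordinates
  \<open>y = s K + L\<close> form a pencil of equivalent divisors (Abel's theorem), and a generic point of the curve lies on
  a member of the pencil. So, up to closure, the set of sums is stable under translation by \<open>\<integral>(1, x, x\<^sup>2) dx / y\<close>
  along any small arc, hence under all of \<open>\<complex>\<^sup>3\<close>.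
\<close>

section \<open>Abelian integrals along paths on the curve\<close>

lemma vector_derivative_joinpaths_left:
  fixes g1 g2 :: "real \<Rightarrow> 'a::real_normed_vector"
  assumes "g1 differentiable at (2 * t)" "t < 1/2"
  shows "vector_derivative (g1 +++ g2) (at t) = 2 *\<^sub>R vector_derivative g1 (at (2 * t))"
proof (rule vector_derivative_at)
  have "((\<lambda>s. g1 (2 * s)) has_vector_derivative 2 *\<^sub>R vector_derivative g1 (at (2 * t))) (at t)"
  proof (rule vector_diff_chain_at [of "\<lambda>s. 2 * s" 2 t g1, unfolded o_def])
    show "((\<lambda>s. 2 * s) has_vector_derivative 2) (at t)"
      by (auto intro!: derivative_eq_intros simp flip: has_real_derivative_iff_has_vector_derivative)
  qed (use assms(1) in \<open>simp add: vector_derivative_works\<close>)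
  then show "((g1 +++ g2) has_vector_derivative 2 *\<^sub>R vector_derivative g1 (at (2 * t))) (at t)"
    by (rule has_vector_derivative_transform_within_open [where S = "{..<1/2}"])
      (use assms(2) in \<open>auto simp: joinpaths_def\<close>)
qed

lemma vector_derivative_joinpaths_right:
  fixes g1 g2 :: "real \<Rightarrow> 'a::real_normed_vector"
  assumes "g2 differentiable at (2 * t - 1)" "1/2 < t"
  shows "vector_derivative (g1 +++ g2) (at t) = 2 *\<^sub>R vector_derivative g2 (at (2 * t - 1))"
proof (rule vector_derivative_at)
  have "((\<lambda>s. g2 (2 * s - 1)) has_vector_derivative 2 *\<^sub>R vector_derivative g2 (at (2 * t - 1))) (at t)"
  proof (rule vector_diff_chain_at [of "\<lambda>s. 2 * s - 1" 2 t g2, unfolded o_def])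
    show "((\<lambda>s. 2 * s - 1) has_vector_derivative 2) (at t)"
      by (auto intro!: derivative_eq_intros simp flip: has_real_derivative_iff_has_vector_derivative)
  qed (use assms(1) in \<open>simp add: vector_derivative_works\<close>)
  then show "((g1 +++ g2) has_vector_derivative 2 *\<^sub>R vector_derivative g2 (at (2 * t - 1))) (at t)"
    by (rule has_vector_derivative_transform_within_open [where S = "{1/2<..}"])
      (use assms(2) in \<open>auto simp: joinpaths_def\<close>)
qed

lemma has_integral_joinpaths:
  fixes f1 f2 :: "real \<Rightarrow> 'a::banach"
  assumes "(f1 has_integral i1) {0..1}" "(f2 has_integral i2) {0..1}"
  shows "((\<lambda>t. 2 *\<^sub>R (f1 +++ f2) t) has_integral i1 + i2) {0..1}"
proof -
  have halves: "((\<lambda>t. 2 *\<^sub>R f1 (2 * t)) has_integral i1) {0..1/2}"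
    "((\<lambda>t. 2 *\<^sub>R f2 (2 * t - 1)) has_integral i2) {1/2..1}"
    using has_integral_affinity01 [OF assms(1), where m = 2 and c = 0, THEN has_integral_cmul [where c = 2]]
      has_integral_affinity01 [OF assms(2), where m = 2 and c = "-1", THEN has_integral_cmul [where c = 2]]
    by (simp_all only: image_affinity_atLeastAtMost_div_diff, simp_all)
  have "((\<lambda>t. 2 *\<^sub>R (f1 +++ f2) t) has_integral i1) {0..1/2}"
    by (rule has_integral_spike_finite [OF _ _ halves(1), where S = "{}"]) (auto simp: joinpaths_def)
  moreover have "((\<lambda>t. 2 *\<^sub>R (f1 +++ f2) t) has_integral i2) {1/2..1}"
    by (rule has_integral_spike_finite [OF _ _ halves(2), where S = "{1/2}"]) (auto simp: joinpaths_def)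
  ultimately show ?thesis
    by (rule has_integral_combine [rotated 2]) auto
qed

lemma has_integral_along_joinpaths:
  fixes g1 g2 :: "real \<Rightarrow> 'a::real_normed_vector" and w1 w2 :: "real \<Rightarrow> 'a \<Rightarrow> 'b::banach"
  assumes int: "((\<lambda>t. w1 t (vector_derivative g1 (at t))) has_integral i1) {0..1}"
      "((\<lambda>t. w2 t (vector_derivative g2 (at t))) has_integral i2) {0..1}"
    and "valid_path g1" "valid_path g2"
    and lin: "\<And>t. linear (w1 t)" "\<And>t. linear (w2 t)"
  shows "((\<lambda>t. (w1 +++ w2) t (vector_derivative (g1 +++ g2) (at t))) has_integral i1 + i2) {0..1}"
proof -
  obtain S1 S2 where S1: "finite S1" "\<And>t. t \<in> {0..1} - S1 \<Longrightarrow> g1 differentiable at t"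
    and S2: "finite S2" "\<And>t. t \<in> {0..1} - S2 \<Longrightarrow> g2 differentiable at t"
    using assms(3,4)
    by (auto simp: valid_path_def piecewise_C1_differentiable_on_def C1_differentiable_on_eq)
  define S where "S = insert (1/2) ((\<lambda>t. 2 * t) -` S1 \<union> (\<lambda>t. 2 * t - 1) -` S2)"
  let ?f1 = "\<lambda>t. w1 t (vector_derivative g1 (at t))" and ?f2 = "\<lambda>t. w2 t (vector_derivative g2 (at t))"
  show ?thesis
  proof (rule has_integral_spike_finite [OF _ _ has_integral_joinpaths [OF int]])
    show "finite S"
      using S1(1) S2(1) by (auto simp: S_def intro!: finite_vimageI inj_onI)
    fix t assume t: "t \<in> {0..1} - S"
    then consider (left) "t < 1/2" | (right) "1/2 < t" by (force simp: S_def)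
    then show "(w1 +++ w2) t (vector_derivative (g1 +++ g2) (at t)) = 2 *\<^sub>R (?f1 +++ ?f2) t"
    proof cases
      case left
      then have "vector_derivative (g1 +++ g2) (at t) = 2 *\<^sub>R vector_derivative g1 (at (2 * t))"
        using t by (intro vector_derivative_joinpaths_left S1(2)) (auto simp: S_def)
      then show ?thesis
        using left lin(1) by (simp add: joinpaths_def [of w1] joinpaths_def [of ?f1] linear_scale)
    next
      case right
      then have "vector_derivative (g1 +++ g2) (at t) = 2 *\<^sub>R vector_derivative g2 (at (2 * t - 1))"
        using t by (intro vector_derivative_joinpaths_right S2(2)) (auto simp: S_def)
      then show ?thesis
        using right lin(2) by (simp add: joinpaths_def [of w1] joinpaths_def [of ?f1] linear_scale)
    qed
  qed
qed

definition du :: "complex \<Rightarrow> complex \<Rightarrow> complex \<Rightarrow> cvec3" where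
  "du x y h = (h / y, x * h / y, x\<^sup>2 * h / y)"

lemma bounded_linear_du: "bounded_linear (du x y)"
  unfolding du_def [abs_def] divide_inverse
  by (intro bounded_linear_Pair bounded_linear_mult_const bounded_linear_const_mult bounded_linear_ident)

text \<open>The integral is required to exist: a valid path may have an unbounded derivative, and the
  integral in \<open>abel_int\<close> is \<open>0\<close> when the integrand is not integrable.\<close>
definition abel_value ::
  "(nat \<Rightarrow> complex) \<Rightarrow> complex \<times> complex \<Rightarrow> complex \<times> complex \<Rightarrow> cvec3 \<Rightarrow> bool" where
  "abel_value a P Q v \<longleftrightarrow> (\<exists>gx gy. curve_path a gx gy P Q \<and>
     ((\<lambda>t. du (gx t) (gy t) (vector_derivative gx (at t))) has_integral v) {0..1})"

definition abel_branch ::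
  "(nat \<Rightarrow> complex) \<Rightarrow> complex set \<Rightarrow> (complex \<Rightarrow> complex) \<Rightarrow> (complex \<Rightarrow> cvec3) \<Rightarrow> bool" where
  "abel_branch a U Y \<Phi> \<longleftrightarrow> open U \<and> convex U \<and> Y holomorphic_on U \<and>
     (\<forall>z\<in>U. (Y z)\<^sup>2 = fC a z \<and> Y z \<noteq> 0 \<and> (\<Phi> has_derivative du z (Y z)) (at z))"

lemma abel_valueE:
  assumes "abel_value a P Q v"
  obtains gx gy where "curve_path a gx gy P Q" "abel gx gy = v"
proof -
  from assms obtain gx gy where path: "curve_path a gx gy P Q"
    and int: "((\<lambda>t. du (gx t) (gy t) (vector_derivative gx (at t))) has_integral v) {0..1}"
    unfolding abel_value_def by blast
  have "abel gx gy = v"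
    using has_integral_linear [OF int bounded_linear_fst]
      has_integral_linear [OF has_integral_linear [OF int bounded_linear_snd] bounded_linear_fst]
      has_integral_linear [OF has_integral_linear [OF int bounded_linear_snd] bounded_linear_snd]
    by (simp add: abel_def abel_int_def du_def o_def prod_eq_iff integral_unique mult_ac)
  with path show thesis by (rule that)
qed

lemma abel_value_on_curve: "abel_value a P (x, y) v \<Longrightarrow> y\<^sup>2 = fC a x \<and> y \<noteq> 0"
  unfolding abel_value_def curve_path_def by force

lemma abel_value_refl:
  assumes "y\<^sup>2 = fC a x" "y \<noteq> 0"
  shows "abel_value a (x, y) (x, y) 0"
proof -
  have "curve_path a (\<lambda>_. x) (\<lambda>_. y) (x, y) (x, y)"
    using assms valid_path_linepath [of x x] by (auto simp: curve_path_def linepath_refl)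
  moreover have "((\<lambda>t. du x y (vector_derivative (\<lambda>_. x) (at t))) has_integral 0) {0..1 :: real}"
    by (simp add: du_def flip: zero_prod_def)
  ultimately show ?thesis unfolding abel_value_def by blast
qed

lemma abel_branchD:
  assumes "abel_branch a U Y \<Phi>"
  shows "open U" "convex U" "Y holomorphic_on U"
    and "z \<in> U \<Longrightarrow> (Y z)\<^sup>2 = fC a z" "z \<in> U \<Longrightarrow> Y z \<noteq> 0"
    and "z \<in> U \<Longrightarrow> (\<Phi> has_derivative du z (Y z)) (at z)"
  using assms by (auto simp: abel_branch_def)

lemma abel_branch_subset:
  assumes "abel_branch a U Y \<Phi>" "V \<subseteq> U" "open V" "convex V"
  shows "abel_branch a V Y \<Phi>"
  using assms unfolding abel_branch_def by (meson holomorphic_on_subset subsetD)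

lemma abel_branch_isCont: "abel_branch a U Y \<Phi> \<Longrightarrow> z \<in> U \<Longrightarrow> isCont \<Phi> z"
  using abel_branchD(6) has_derivative_continuous by blast

lemma abel_branch_linepath_in: "abel_branch a U Y \<Phi> \<Longrightarrow> z \<in> U \<Longrightarrow> w \<in> U \<Longrightarrow> t \<in> {0..1} \<Longrightarrow> linepath z w t \<in> U"
  by (auto simp: linepath_def intro!: convexD dest: abel_branchD(2))

lemma abel_branch_has_integral_linepath:
  assumes br: "abel_branch a U Y \<Phi>" and "z \<in> U" "w \<in> U"
  defines "l \<equiv> linepath z w"
  shows "((\<lambda>t. du (l t) (Y (l t)) (vector_derivative l (at t))) has_integral \<Phi> w - \<Phi> z) {0..1}"
proof -
  have "((\<lambda>t. \<Phi> (l t)) has_vector_derivative du (l t) (Y (l t)) (w - z)) (at t within {0..1})"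
    if "t \<in> {0..1}" for t
    unfolding has_vector_derivative_def
  proof (rule has_derivative_eq_rhs)
    have "(\<Phi> has_derivative du (l t) (Y (l t))) (at (l t))"
      using abel_branchD(6) [OF br] abel_branch_linepath_in [OF br assms(2,3) that] unfolding l_def by blast
    then show "((\<lambda>t. \<Phi> (l t)) has_derivative (\<lambda>h. du (l t) (Y (l t)) (h *\<^sub>R (w - z)))) (at t within {0..1})"
      using has_derivative_compose [OF has_vector_derivative_linepath_within [unfolded has_vector_derivative_def]]
      unfolding l_def by blast
  qed (simp add: linear_scale bounded_linear.linear [OF bounded_linear_du])
  from fundamental_theorem_of_calculus [OF zero_le_one this] show ?thesis
    by (simp add: l_def linepath_0' linepath_1')
qed

lemma curve_path_join_branch:
  assumes g: "curve_path a gx gy P (z, Y z)" and br: "abel_branch a U Y \<Phi>" and zw: "z \<in> U" "w \<in> U"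
  shows "curve_path a (gx +++ linepath z w) (gy +++ (\<lambda>t. Y (linepath z w t))) P (w, Y w)"
proof -
  let ?l = "linepath z w"
  have inU: "?l t \<in> U" if "t \<in> {0..1}" for t
    using abel_branch_linepath_in [OF br zw that] .
  have "continuous_on {0..1} (\<lambda>t. Y (?l t))"
  proof (rule continuous_on_compose2 [of U Y])
    show "continuous_on U Y"
      using abel_branchD(3) [OF br] by (rule holomorphic_on_imp_continuous_on)
  qed (use inU in \<open>auto intro: continuous_on_linepath\<close>)
  then have "path (gy +++ (\<lambda>t. Y (?l t)))"
    using g by (intro path_join_imp)
      (auto simp: curve_path_def path_def pathfinish_def pathstart_def linepath_def)
  moreover have "valid_path (gx +++ ?l)"
    using g by (intro valid_path_join) (auto simp: curve_path_def pathfinish_def)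
  moreover have "((gy +++ (\<lambda>t. Y (?l t))) t)\<^sup>2 = fC a ((gx +++ ?l) t) \<and> (gy +++ (\<lambda>t. Y (?l t))) t \<noteq> 0"
    if "t \<in> {0..1}" for t
    using g that abel_branchD(4,5) [OF br inU] by (auto simp: curve_path_def joinpaths_def)
  ultimately show ?thesis
    using g by (auto simp: curve_path_def path_def joinpaths_def linepath_def)
qed

lemma abel_value_extend:
  assumes "abel_value a P (z, Y z) v" and br: "abel_branch a U Y \<Phi>" and zw: "z \<in> U" "w \<in> U"
  shows "abel_value a P (w, Y w) (v + (\<Phi> w - \<Phi> z))"
proof -
  from assms(1) obtain gx gy where path: "curve_path a gx gy P (z, Y z)"
    and int: "((\<lambda>t. du (gx t) (gy t) (vector_derivative gx (at t))) has_integral v) {0..1}"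
    unfolding abel_value_def by blast
  let ?l = "linepath z w"
  let ?gx = "gx +++ ?l" and ?gy = "gy +++ (\<lambda>t. Y (?l t))"
  have "(\<lambda>t. du (?gx t) (?gy t)) = (\<lambda>t. du (gx t) (gy t)) +++ (\<lambda>t. du (?l t) (Y (?l t)))"
    by (auto simp: joinpaths_def)
  then have "((\<lambda>t. du (?gx t) (?gy t) (vector_derivative ?gx (at t))) has_integral v + (\<Phi> w - \<Phi> z)) {0..1}"
    using has_integral_along_joinpaths [where ?w1.0 = "\<lambda>t. du (gx t) (gy t)" and ?w2.0 = "\<lambda>t. du (?l t) (Y (?l t))",
        OF int abel_branch_has_integral_linepath [OF br zw]] path
    by (simp add: curve_path_def bounded_linear.linear [OF bounded_linear_du] fun_eq_iff)
  with curve_path_join_branch [OF path br zw] show ?thesis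
    unfolding abel_value_def by blast
qed

lemma holomorphic_on_fC: "fC a holomorphic_on S"
  unfolding fC_def [abs_def] by (intro holomorphic_intros)

lemma holomorphic_sqrt_exists_near:
  assumes f: "f holomorphic_on S" "open S" "x \<in> S" and y: "y\<^sup>2 = f x" "y \<noteq> 0"
  obtains r Y where "r > 0" "Y holomorphic_on ball x r" "Y x = y"
    "\<And>z. z \<in> ball x r \<Longrightarrow> (Y z)\<^sup>2 = f z \<and> Y z \<noteq> 0"
proof -
  have "open (S \<inter> f -` (- {0}))"
    using holomorphic_on_imp_continuous_on [OF f(1)] f(2) by (intro continuous_open_preimage) auto
  moreover have "x \<in> S \<inter> f -` (- {0})"
    using f(3) y by auto
  ultimately obtain r where r: "r > 0" "ball x r \<subseteq> S \<inter> f -` (- {0})"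
    using open_contains_ball by metis
  then have nz: "f z \<noteq> 0" if "z \<in> ball x r" for z
    using that by auto
  have "f holomorphic_on ball x r"
    using f(1) by (rule holomorphic_on_subset) (use r(2) in blast)
  from contractible_imp_holomorphic_sqrt [OF this convex_imp_contractible [OF convex_ball] nz]
  obtain g where g: "g holomorphic_on ball x r" "\<And>z. z \<in> ball x r \<Longrightarrow> f z = (g z)\<^sup>2"
    by blast
  have sign: "g x = y \<or> g x = - y"
    using y g(2) [of x] r(1) by (metis centre_in_ball power2_eq_iff)
  show thesis
  proof (rule that [OF r(1)])
    show "(\<lambda>z. g z * (g x / y)) holomorphic_on ball x r"
      using g(1) by (intro holomorphic_intros)
    show "(g z * (g x / y))\<^sup>2 = f z \<and> g z * (g x / y) \<noteq> 0" if "z \<in> ball x r" for z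
      using sign g(2) [OF that] nz [OF that] y by (auto simp: power_mult_distrib power_divide)
  qed (use sign y in auto)
qed

lemma abel_branch_exists:
  assumes "y\<^sup>2 = fC a x" "y \<noteq> 0"
  obtains r Y \<Phi> where "r > 0" "abel_branch a (ball x r) Y \<Phi>" "Y x = y"
proof -
  obtain r Y where r: "r > 0" and Y: "Y holomorphic_on ball x r" "Y x = y"
    and sq: "\<And>z. z \<in> ball x r \<Longrightarrow> (Y z)\<^sup>2 = fC a z \<and> Y z \<noteq> 0"
    using holomorphic_sqrt_exists_near [OF holomorphic_on_fC open_UNIV UNIV_I assms] by blast
  have "\<exists>p. \<forall>z\<in>ball x r. (p has_field_derivative z ^ k / Y z) (at z)" for k :: nat
  proof -
    have "(\<lambda>z. z ^ k / Y z) holomorphic_on ball x r"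
      using Y(1) sq by (intro holomorphic_intros) auto
    from holomorphic_convex_primitive' [OF convex_ball open_ball this]
    show ?thesis using at_within_open [OF _ open_ball] by metis
  qed
  then obtain p where p: "\<And>k z. z \<in> ball x r \<Longrightarrow> (p k has_derivative (\<lambda>h. z ^ k / Y z * h)) (at z)"
    unfolding has_field_derivative_def by metis
  have "((\<lambda>z. (p 0 z, p 1 z, p 2 z)) has_derivative du z (Y z)) (at z)" if "z \<in> ball x r" for z
    using has_derivative_Pair [OF p [OF that, of 0] has_derivative_Pair [OF p [OF that, of 1] p [OF that, of 2]]]
    by (simp add: du_def [abs_def])
  then have "abel_branch a (ball x r) Y (\<lambda>z. (p 0 z, p 1 z, p 2 z))"
    unfolding abel_branch_def using Y(1) sq by simp
  with r Y(2) show thesis using that by blast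
qed

definition abel_sum ::
  "(nat \<Rightarrow> complex) \<Rightarrow> complex \<times> complex \<Rightarrow> complex set \<Rightarrow> (complex \<Rightarrow> complex) \<Rightarrow> cvec3 \<Rightarrow> bool" where
  "abel_sum a P Z \<eta> u \<longleftrightarrow> (\<exists>V. (\<forall>z\<in>Z. abel_value a P (z, \<eta> z) (V z)) \<and> u = (\<Sum>z\<in>Z. V z))"

lemma abel_sum_on_curve: "abel_sum a P Z \<eta> u \<Longrightarrow> z \<in> Z \<Longrightarrow> (\<eta> z)\<^sup>2 = fC a z \<and> \<eta> z \<noteq> 0"
  unfolding abel_sum_def using abel_value_on_curve by blast

lemma abel_sum_image:
  assumes "inj_on \<alpha> I"
  shows "abel_sum a P (\<alpha> ` I) \<eta> u \<longleftrightarrow>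
    (\<exists>V. (\<forall>i\<in>I. abel_value a P (\<alpha> i, \<eta> (\<alpha> i)) (V i)) \<and> u = (\<Sum>i\<in>I. V i))"
proof
  assume "abel_sum a P (\<alpha> ` I) \<eta> u"
  then obtain V where "\<forall>z\<in>\<alpha> ` I. abel_value a P (z, \<eta> z) (V z)" "u = (\<Sum>z\<in>\<alpha> ` I. V z)"
    unfolding abel_sum_def by blast
  then show "\<exists>V. (\<forall>i\<in>I. abel_value a P (\<alpha> i, \<eta> (\<alpha> i)) (V i)) \<and> u = (\<Sum>i\<in>I. V i)"
    using assms by (intro exI [of _ "V \<circ> \<alpha>"]) (auto simp: sum.reindex)
next
  assume "\<exists>V. (\<forall>i\<in>I. abel_value a P (\<alpha> i, \<eta> (\<alpha> i)) (V i)) \<and> u = (\<Sum>i\<in>I. V i)"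
  then obtain V where "\<forall>i\<in>I. abel_value a P (\<alpha> i, \<eta> (\<alpha> i)) (V i)" "u = (\<Sum>i\<in>I. V i)"
    by blast
  then show "abel_sum a P (\<alpha> ` I) \<eta> u"
    unfolding abel_sum_def using assms
    by (intro exI [of _ "V \<circ> inv_into I \<alpha>"]) (auto simp: sum.reindex)
qed

lemma abel_sum_transport:
  assumes \<alpha>: "inj_on \<alpha> I" "\<And>i. i \<in> I \<Longrightarrow> \<alpha> i \<in> U i" "\<And>i. i \<in> I \<Longrightarrow> \<eta> (\<alpha> i) = Y i (\<alpha> i)"
    and \<beta>: "inj_on \<beta> I" "\<And>i. i \<in> I \<Longrightarrow> \<beta> i \<in> U i" "\<And>i. i \<in> I \<Longrightarrow> \<theta> (\<beta> i) = Y i (\<beta> i)"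
    and br: "\<And>i. i \<in> I \<Longrightarrow> abel_branch a (U i) (Y i) (\<Phi> i)"
    and sum: "abel_sum a P (\<alpha> ` I) \<eta> u"
  shows "abel_sum a P (\<beta> ` I) \<theta> (u + (\<Sum>i\<in>I. \<Phi> i (\<beta> i) - \<Phi> i (\<alpha> i)))"
proof -
  obtain V where V: "\<And>i. i \<in> I \<Longrightarrow> abel_value a P (\<alpha> i, \<eta> (\<alpha> i)) (V i)" and u: "u = (\<Sum>i\<in>I. V i)"
    using sum unfolding abel_sum_image [OF \<alpha>(1)] by blast
  have "abel_value a P (\<beta> i, \<theta> (\<beta> i)) (V i + (\<Phi> i (\<beta> i) - \<Phi> i (\<alpha> i)))" if "i \<in> I" for i
    using abel_value_extend [OF _ br [OF that] \<alpha>(2) [OF that] \<beta>(2) [OF that]] V [OF that]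
    by (simp add: \<alpha>(3) [OF that] \<beta>(3) [OF that])
  then show ?thesis
    unfolding abel_sum_image [OF \<beta>(1)]
    by (intro exI [of _ "\<lambda>i. V i + (\<Phi> i (\<beta> i) - \<Phi> i (\<alpha> i))"]) (simp add: u sum.distrib)
qed

lemma card_insert_remove_other:
  assumes "finite Z" "z \<in> Z" "w \<notin> Z - {z}"
  shows "card (insert w (Z - {z})) = card Z"
  using assms card_insert_disjoint [of "Z - {z}" w] card_Suc_Diff1 [of Z z]
  by (metis finite_Diff)

lemma abel_sum_move_point:
  assumes sum: "abel_sum a P Z \<eta> u" "finite Z" and z: "z \<in> Z" "Y z = \<eta> z" and w: "w \<notin> Z - {z}"
    and br: "abel_branch a U Y \<Phi>" "z \<in> U" "w \<in> U"
  shows "abel_sum a P (insert w (Z - {z})) (\<eta>(w := Y w)) (u + (\<Phi> w - \<Phi> z))"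
proof -
  obtain V where V: "\<And>x. x \<in> Z \<Longrightarrow> abel_value a P (x, \<eta> x) (V x)" and u: "u = (\<Sum>x\<in>Z. V x)"
    using sum(1) unfolding abel_sum_def by blast
  define V' where "V' = V(w := V z + (\<Phi> w - \<Phi> z))"
  have "abel_value a P (w, Y w) (V z + (\<Phi> w - \<Phi> z))"
    using abel_value_extend [OF _ br] V [OF z(1)] z(2) by simp
  then have "\<forall>x\<in>insert w (Z - {z}). abel_value a P (x, (\<eta>(w := Y w)) x) (V' x)"
    using V by (simp add: V'_def)
  moreover have "(\<Sum>x\<in>Z - {z}. V' x) = (\<Sum>x\<in>Z - {z}. V x)"
    using w by (intro sum.cong) (auto simp: V'_def)
  then have "u + (\<Phi> w - \<Phi> z) = (\<Sum>x\<in>insert w (Z - {z}). V' x)"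
    using sum(2) z(1) w by (simp add: u V'_def sum_diff1)
  ultimately show ?thesis unfolding abel_sum_def by blast
qed

section \<open>Lagrange interpolation\<close>

definition root_poly :: "'a::idom set \<Rightarrow> 'a poly" where
  "root_poly Z = (\<Prod>z\<in>Z. [:- z, 1:])"

lemma poly_root_poly_eq_0_iff: "finite Z \<Longrightarrow> poly (root_poly Z) x = 0 \<longleftrightarrow> x \<in> Z"
  by (auto simp: root_poly_def poly_prod)

lemma degree_root_poly [simp]: "degree (root_poly Z) = card Z"
  by (simp add: root_poly_def degree_prod_sum_eq)

lemma coeff_root_poly_card [simp]: "coeff (root_poly Z) (card Z) = 1"
  by (simp add: root_poly_def lead_coeff_prod flip: degree_root_poly)

lemma root_poly_nonzero [simp]: "root_poly Z \<noteq> 0"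
  using coeff_root_poly_card [of Z] by (metis coeff_0 zero_neq_one)

lemma poly_pderiv_root_poly:
  assumes "finite Z" "z \<in> Z"
  shows "poly (pderiv (root_poly Z)) z = poly (root_poly (Z - {z})) z"
proof -
  have "root_poly Z = [:- z, 1:] * root_poly (Z - {z})"
    using assms by (simp add: root_poly_def prod.remove)
  then show ?thesis by (simp only: pderiv_mult) (simp add: pderiv_pCons)
qed

lemma poly_pderiv_root_poly_nonzero: "finite Z \<Longrightarrow> z \<in> Z \<Longrightarrow> poly (pderiv (root_poly Z)) z \<noteq> 0"
  by (simp add: poly_pderiv_root_poly poly_root_poly_eq_0_iff)

lemma root_poly_dvd:
  fixes p :: "'a::field poly"
  assumes "finite Z" "\<And>z. z \<in> Z \<Longrightarrow> poly p z = 0"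
  shows "root_poly Z dvd p"
proof (cases "Z = {}")
  case False
  have "p mod root_poly Z = 0"
  proof (rule poly_eqI_degree [where A = Z])
    show "poly (p mod root_poly Z) z = poly 0 z" if "z \<in> Z" for z
      using assms that by (simp add: poly_mod poly_root_poly_eq_0_iff)
    show "degree (p mod root_poly Z) < card Z"
      using degree_mod_less [of "root_poly Z" p] False assms(1) by (auto simp: card_gt_0_iff)
  qed (use False assms(1) in \<open>simp add: card_gt_0_iff\<close>)
  then show ?thesis by (simp add: mod_eq_0_iff_dvd)
qed (simp add: root_poly_def)

definition lagrange :: "'a::field set \<Rightarrow> ('a \<Rightarrow> 'a) \<Rightarrow> 'a poly" where
  "lagrange Z g = (\<Sum>z\<in>Z. smult (g z / poly (pderiv (root_poly Z)) z) (root_poly (Z - {z})))"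

lemma poly_lagrange:
  assumes "finite Z" "w \<in> Z"
  shows "poly (lagrange Z g) w = g w"
proof -
  have "poly (lagrange Z g) w = (\<Sum>z\<in>Z. if z = w then g w else 0)"
    unfolding lagrange_def poly_sum poly_smult
  proof (rule sum.cong)
    fix z assume "z \<in> Z"
    show "g z / poly (pderiv (root_poly Z)) z * poly (root_poly (Z - {z})) w = (if z = w then g w else 0)"
      using poly_root_poly_eq_0_iff [of "Z - {z}" w] assms poly_pderiv_root_poly [OF assms]
      by auto
  qed simp
  then show ?thesis using assms by simp
qed

lemma degree_lagrange_less: "finite Z \<Longrightarrow> Z \<noteq> {} \<Longrightarrow> degree (lagrange Z g) < card Z"
  unfolding lagrange_def
  by (rule degree_sum_less) (auto simp: card_gt_0_iff intro: le_less_trans [OF degree_smult_le])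

lemma coeff_lagrange:
  assumes "finite Z"
  shows "coeff (lagrange Z g) (card Z - 1) = (\<Sum>z\<in>Z. g z / poly (pderiv (root_poly Z)) z)"
  unfolding lagrange_def coeff_sum
proof (rule sum.cong)
  fix z assume "z \<in> Z"
  then have "card Z - 1 = card (Z - {z})" using assms by simp
  then show "coeff (smult (g z / poly (pderiv (root_poly Z)) z) (root_poly (Z - {z}))) (card Z - 1) =
      g z / poly (pderiv (root_poly Z)) z"
    by (simp only: coeff_smult coeff_root_poly_card mult_1_right)
qed simp

lemma lagrange_poly:
  fixes p :: "'a::field poly"
  assumes "degree p < card Z"
  shows "lagrange Z (poly p) = p"
proof (rule poly_eqI_degree)
  have Z: "finite Z" "Z \<noteq> {}" using assms by (auto intro: ccontr)
  show "poly (lagrange Z (poly p)) z = poly p z" if "z \<in> Z" for z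
    using poly_lagrange Z(1) that .
  show "degree (lagrange Z (poly p)) < card Z"
    using degree_lagrange_less Z .
qed (rule assms)

lemma sum_poly_over_pderiv_root_poly_eq_0:
  fixes p :: "'a::field poly"
  assumes "degree p + 2 \<le> card Z"
  shows "(\<Sum>z\<in>Z. poly p z / poly (pderiv (root_poly Z)) z) = 0"
proof -
  have "finite Z" using assms by (auto intro: ccontr)
  then have "(\<Sum>z\<in>Z. poly p z / poly (pderiv (root_poly Z)) z) = coeff p (card Z - 1)"
    using assms lagrange_poly [of p Z] by (simp flip: coeff_lagrange)
  also have "\<dots> = 0" using assms by (intro coeff_eq_0) linarith
  finally show ?thesis .
qed

lemma rsquarefree_eq_smult_root_poly:
  fixes p :: "complex poly"
  shows "rsquarefree p \<Longrightarrow> p = smult (lead_coeff p) (root_poly {z. poly p z = 0})"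
  using complex_poly_decompose_rsquarefree by (simp add: root_poly_def)

lemma card_roots_rsquarefree:
  fixes p :: "complex poly"
  assumes "rsquarefree p"
  shows "card {z. poly p z = 0} = degree p"
proof -
  have "p \<noteq> 0" using assms by (simp add: rsquarefree_def)
  then show ?thesis
    using arg_cong [OF rsquarefree_eq_smult_root_poly [OF assms], of degree] by simp
qed

lemma sum_roots_poly_over_pderiv_eq_0:
  fixes p q :: "complex poly"
  assumes "rsquarefree p" "degree q + 2 \<le> degree p"
  shows "(\<Sum>z | poly p z = 0. poly q z / poly (pderiv p) z) = 0"
proof -
  let ?Z = "{z. poly p z = 0}"
  have "poly (pderiv p) z = lead_coeff p * poly (pderiv (root_poly ?Z)) z" for z
    using arg_cong [OF rsquarefree_eq_smult_root_poly [OF assms(1)], of "\<lambda>p. poly (pderiv p) z"]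
    by (simp add: pderiv_smult)
  then have "(\<Sum>z\<in>?Z. poly q z / poly (pderiv p) z) =
      (\<Sum>z\<in>?Z. poly q z / poly (pderiv (root_poly ?Z)) z) / lead_coeff p"
    by (simp add: sum_divide_distrib mult.commute)
  then show ?thesis
    using sum_poly_over_pderiv_root_poly_eq_0 [of q ?Z] assms by (simp add: card_roots_rsquarefree)
qed

lemma interpolation_factorization:
  fixes f :: "'a::field poly"
  assumes Z: "finite Z" "Z \<noteq> {}" and f: "degree f = 2 * card Z" "\<And>z. z \<in> Z \<Longrightarrow> (\<eta> z)\<^sup>2 = poly f z"
  obtains L K where "f = L\<^sup>2 + K * root_poly Z" "degree L < card Z" "degree K = card Z"
    "\<forall>z\<in>Z. poly L z = \<eta> z"
proof -
  define L where "L = lagrange Z \<eta>"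
  have L: "poly L z = \<eta> z" if "z \<in> Z" for z
    using poly_lagrange [OF Z(1) that] by (simp add: L_def)
  have dL: "degree L < card Z"
    using degree_lagrange_less [OF Z] by (simp add: L_def)
  have "root_poly Z dvd f - L\<^sup>2"
    using Z(1) L f(2) by (intro root_poly_dvd) auto
  then obtain K where K: "f - L\<^sup>2 = K * root_poly Z" by (auto simp: mult.commute)
  have "degree (f - L\<^sup>2) = degree f"
    using degree_add_eq_left [of "- L\<^sup>2" f] degree_power_le [of L 2] dL f(1) by simp
  then have "degree (K * root_poly Z) = 2 * card Z" "K \<noteq> 0"
    using f(1) K Z by auto
  then have "degree K = card Z" by (simp add: degree_mult_eq)
  then show thesis using that [of L K] K dL L by (auto simp: algebra_simps)
qed

section \<open>Pencils of divisors\<close>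

locale pencil =
  fixes f L K W :: "complex poly"
  assumes rsquarefree: "rsquarefree f"
    and factorization: "f = L\<^sup>2 + K * W"
    and degree_K: "degree K = degree W"
    and degree_L: "degree L < degree W"
begin

definition member :: "complex \<Rightarrow> complex poly" where
  "member s = smult (s\<^sup>2) K + smult (2 * s) L - W"

definition ordinate :: "complex \<Rightarrow> complex poly" where
  "ordinate s = smult s K + L"

abbreviation roots :: "complex \<Rightarrow> complex set" where
  "roots s \<equiv> {z. poly (member s) z = 0}"

definition exceptional :: "complex set" where
  "exceptional = {s. degree (member s) \<noteq> degree W \<or>
     (\<exists>x\<in>roots s. poly (pderiv (member s)) x = 0 \<or> poly f x = 0)}"

lemma K_mult_member: "K * member s = (ordinate s)\<^sup>2 - f"
  unfolding poly_eq_poly_eq_iff [symmetric]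
  by (rule ext) (simp add: member_def ordinate_def factorization power2_eq_square algebra_simps)

lemma ordinate_square: "x \<in> roots s \<Longrightarrow> (poly (ordinate s) x)\<^sup>2 = poly f x"
  using arg_cong [OF K_mult_member, of "\<lambda>p. poly p x" s] by simp

lemma member_ordinate_iff:
  "x \<in> roots s \<and> poly (ordinate s) x = y \<longleftrightarrow>
    s * poly K x = y - poly L x \<and> s * (y + poly L x) = poly W x"
  by (auto simp: member_def ordinate_def power2_eq_square algebra_simps)

lemma degree_f: "degree f = 2 * degree W"
proof -
  have "degree (K * W) = 2 * degree W"
    using degree_K degree_L by (subst degree_mult_eq) auto
  moreover have "degree (L\<^sup>2) < 2 * degree W"
    using degree_power_le [of L 2] degree_L by simp
  ultimately show ?thesis
    unfolding factorization by (simp add: degree_add_eq_right)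
qed

lemma f_root_simple: "poly f x = 0 \<Longrightarrow> poly (pderiv f) x \<noteq> 0"
  using rsquarefree by (auto simp: rsquarefree_roots)

lemma ex_root_f: "\<exists>x. poly f x = 0"
  using card_roots_rsquarefree [OF rsquarefree] degree_f degree_L
  by (metis (mono_tags, lifting) Collect_empty_eq card.empty mult_is_0 not_less_zero zero_neq_numeral)

lemma finite_parameters_through: "finite {s. x \<in> roots s}"
proof -
  have "[:- poly W x, 2 * poly L x, poly K x:] \<noteq> 0"
  proof
    assume "[:- poly W x, 2 * poly L x, poly K x:] = 0"
    then have "poly f x = 0" "poly (pderiv f) x = 0"
      by (simp_all add: factorization pderiv_add pderiv_mult power2_eq_square)
    then show False using f_root_simple by blast
  qed
  from poly_roots_finite [OF this] show ?thesis
    by (simp add: member_def power2_eq_square algebra_simps)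
qed

lemma member_nonzero: "member s \<noteq> 0"
proof
  assume "member s = 0"
  then have f: "f = (ordinate s)\<^sup>2"
    using K_mult_member [of s] by simp
  obtain x where "poly f x = 0" using ex_root_f by blast
  then have "poly (pderiv f) x = 0"
    unfolding f by (simp add: power2_eq_square pderiv_mult)
  with \<open>poly f x = 0\<close> show False using f_root_simple by blast
qed

definition eliminant :: "complex poly" where
  "eliminant = (K * pderiv f - 2 * f * pderiv K)\<^sup>2 - 4 * f * (L * pderiv K - pderiv L * K)\<^sup>2"

text \<open>Differentiate \<open>K M\<^sub>s = y\<^sup>2 - f\<close>, where \<open>y = s K + L\<close>, and eliminate \<open>s\<close> and \<open>y\<close>.\<close>
lemma poly_eliminant_eq_0:
  assumes "x \<in> roots s" "poly (pderiv (member s)) x = 0"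
  shows "poly eliminant x = 0"
proof -
  define y where "y = poly (ordinate s) x"
  have y: "y\<^sup>2 = poly f x" "s * poly K x = y - poly L x"
    using ordinate_square [OF assms(1)] by (simp_all add: y_def ordinate_def)
  have "2 * y * (s * poly (pderiv K) x + poly (pderiv L) x) = poly (pderiv f) x"
    using arg_cong [OF K_mult_member, of "\<lambda>p. poly (pderiv p) x" s] assms
    by (simp add: pderiv_mult pderiv_diff pderiv_add pderiv_smult power2_eq_square ordinate_def y_def
        algebra_simps)
  then have "poly (K * pderiv f - 2 * f * pderiv K) x = - 2 * y * poly (L * pderiv K - pderiv L * K) x"
  proof -
    assume slope: "2 * y * (s * poly (pderiv K) x + poly (pderiv L) x) = poly (pderiv f) x"
    have "poly K x * poly (pderiv f) x =
        2 * y * ((s * poly K x) * poly (pderiv K) x + poly (pderiv L) x * poly K x)"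
      unfolding slope [symmetric] by (simp add: algebra_simps)
    then show ?thesis
      unfolding y(2) by (simp add: power2_eq_square algebra_simps flip: y(1))
  qed
  then have "(poly (K * pderiv f - 2 * f * pderiv K) x)\<^sup>2 =
      4 * y\<^sup>2 * (poly (L * pderiv K - pderiv L * K) x)\<^sup>2"
    by (simp only: power_mult_distrib) simp
  then show ?thesis by (simp add: eliminant_def y(1))
qed

lemma eliminant_nonzero: "eliminant \<noteq> 0"
proof
  assume eq: "eliminant = 0"
  have K: "K \<noteq> 0" using degree_K degree_L by auto
  have "card {x. poly K x = 0} < card {x. poly f x = 0}"
    using card_poly_roots_bound [OF K] card_roots_rsquarefree [OF rsquarefree] degree_f degree_K degree_L
    by simp
  then have "\<not> {x. poly f x = 0} \<subseteq> {x. poly K x = 0}"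
    using card_mono [OF poly_roots_finite [OF K]] by (meson not_le)
  then obtain e where e: "poly f e = 0" "poly K e \<noteq> 0" by blast
  then show False
    using arg_cong [OF eq, of "\<lambda>p. poly p e"] f_root_simple by (simp add: eliminant_def)
qed

lemma finite_degree_member_drop: "finite {s. degree (member s) \<noteq> degree W}"
proof -
  have "[:- lead_coeff W, 0, lead_coeff K:] \<noteq> 0"
    using degree_L by auto
  then have "finite {s. poly [:- lead_coeff W, 0, lead_coeff K:] s = 0}"
    by (rule poly_roots_finite)
  moreover have "degree (member s) = degree W" if "poly [:- lead_coeff W, 0, lead_coeff K:] s \<noteq> 0" for s
  proof (rule antisym)
    show "degree (member s) \<le> degree W"
      unfolding member_def using degree_K degree_L by (intro degree_diff_le degree_add_le) auto
    have "coeff (member s) (degree W) \<noteq> 0"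
      using that degree_K degree_L by (simp add: member_def coeff_eq_0 power2_eq_square algebra_simps)
    then show "degree W \<le> degree (member s)" by (rule le_degree)
  qed
  then have "{s. degree (member s) \<noteq> degree W} \<subseteq> {s. poly [:- lead_coeff W, 0, lead_coeff K:] s = 0}"
    by blast
  ultimately show ?thesis by (rule finite_subset [rotated])
qed

lemma finite_exceptional: "finite exceptional"
proof -
  define E where "E = {x. poly f x = 0} \<union> {x. poly eliminant x = 0}"
  have "f \<noteq> 0" using degree_f degree_L by auto
  then have "finite E"
    unfolding E_def using poly_roots_finite eliminant_nonzero by blast
  moreover have "exceptional \<subseteq> {s. degree (member s) \<noteq> degree W} \<union> (\<Union>x\<in>E. {s. x \<in> roots s})"
    unfolding exceptional_def E_def using poly_eliminant_eq_0 by blast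
  ultimately show ?thesis
    using finite_degree_member_drop finite_parameters_through by (meson finite_UN finite_Un finite_subset)
qed

lemma rsquarefree_member: "s \<notin> exceptional \<Longrightarrow> rsquarefree (member s)"
  unfolding rsquarefree_roots exceptional_def by auto

lemma degree_member: "s \<notin> exceptional \<Longrightarrow> degree (member s) = degree W"
  by (auto simp: exceptional_def)

lemma card_roots: "s \<notin> exceptional \<Longrightarrow> card (roots s) = degree W"
  using card_roots_rsquarefree [OF rsquarefree_member] degree_member by simp

lemma finite_roots: "finite (roots s)"
  by (rule poly_roots_finite [OF member_nonzero])

text \<open>On the curve \<open>s = (y - L) / K = W / (y + L)\<close>, and one of the denominators is nonzero where \<open>y \<noteq> 0\<close>.\<close>
lemma
  assumes "y\<^sup>2 = poly f x"
  shows on_member_via_K: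
      "poly K x \<noteq> 0 \<Longrightarrow> s * poly K x = y - poly L x \<Longrightarrow> x \<in> roots s \<and> poly (ordinate s) x = y"
    and on_member_via_W:
      "y + poly L x \<noteq> 0 \<Longrightarrow> s * (y + poly L x) = poly W x \<Longrightarrow> x \<in> roots s \<and> poly (ordinate s) x = y"
proof -
  have KW: "(y - poly L x) * (y + poly L x) = poly K x * poly W x"
    using assms by (simp add: factorization power2_eq_square algebra_simps)
  show "x \<in> roots s \<and> poly (ordinate s) x = y" if "poly K x \<noteq> 0" "s * poly K x = y - poly L x"
  proof -
    have "poly K x * (s * (y + poly L x)) = poly K x * poly W x"
      using KW that(2) by (metis mult.assoc mult.commute)
    then show ?thesis unfolding member_ordinate_iff using that by simp
  qed
  show "x \<in> roots s \<and> poly (ordinate s) x = y" if "y + poly L x \<noteq> 0" "s * (y + poly L x) = poly W x"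
  proof -
    have "(y + poly L x) * (s * poly K x) = (y + poly L x) * (y - poly L x)"
      using KW that(2) by (metis mult.assoc mult.commute)
    then show ?thesis unfolding member_ordinate_iff using that by simp
  qed
qed

lemma local_parameter:
  assumes U: "open U" "z \<in> U" and Y: "Y holomorphic_on U" "\<And>x. x \<in> U \<Longrightarrow> (Y x)\<^sup>2 = poly f x" "Y z \<noteq> 0"
    and z: "z \<in> roots s" "poly (ordinate s) z = Y z"
  obtains V \<sigma> where "open V" "z \<in> V" "V \<subseteq> U" "\<sigma> holomorphic_on V" "\<sigma> z = s"
    "\<And>x. x \<in> V \<Longrightarrow> x \<in> roots (\<sigma> x) \<and> poly (ordinate (\<sigma> x)) x = Y x"
proof -
  have s: "s * poly K z = Y z - poly L z" "s * (Y z + poly L z) = poly W z"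
    using z member_ordinate_iff by blast+
  obtain num den where hol: "num holomorphic_on U" "den holomorphic_on U"
    and den: "den z \<noteq> 0" "s * den z = num z"
    and param: "\<And>x t. x \<in> U \<Longrightarrow> den x \<noteq> 0 \<Longrightarrow> t * den x = num x \<Longrightarrow> x \<in> roots t \<and> poly (ordinate t) x = Y x"
  proof (cases "poly K z = 0")
    case False
    show thesis
      by (rule that [of "\<lambda>x. Y x - poly L x" "poly K"])
        (use Y(1) False s on_member_via_K [OF Y(2)] in \<open>auto intro!: holomorphic_intros\<close>)
  next
    case True
    show thesis
      by (rule that [of "poly W" "\<lambda>x. Y x + poly L x"])
        (use Y(1,3) True s on_member_via_W [OF Y(2)] in \<open>auto intro!: holomorphic_intros\<close>)
  qed
  define V where "V = U \<inter> den -` (- {0})"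
  show thesis
  proof (rule that [of V "\<lambda>x. num x / den x"])
    show "open V"
      unfolding V_def using hol(2) U(1) holomorphic_on_imp_continuous_on
      by (intro continuous_open_preimage) auto
    show "(\<lambda>x. num x / den x) holomorphic_on V"
      using hol by (intro holomorphic_intros) (auto simp: V_def intro: holomorphic_on_subset)
    show "x \<in> roots (num x / den x) \<and> poly (ordinate (num x / den x)) x = Y x" if "x \<in> V" for x
      using that param by (simp add: V_def)
  qed (use den U(2) in \<open>auto simp: V_def simp flip: den(2)\<close>)
qed

lemma parameter_derivative:
  assumes V: "open V" "x \<in> V" and \<sigma>: "\<sigma> holomorphic_on V" "\<And>x. x \<in> V \<Longrightarrow> x \<in> roots (\<sigma> x)"
  shows "poly (pderiv (member (\<sigma> x))) x + 2 * poly (ordinate (\<sigma> x)) x * deriv \<sigma> x = 0"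
proof -
  have D: "(\<sigma> has_field_derivative deriv \<sigma> x) (at x)"
    using \<sigma>(1) V holomorphic_derivI by blast
  have "((\<lambda>x. (\<sigma> x)\<^sup>2 * poly K x + 2 * \<sigma> x * poly L x - poly W x) has_field_derivative
      poly (pderiv (member (\<sigma> x))) x + 2 * poly (ordinate (\<sigma> x)) x * deriv \<sigma> x) (at x)"
    by (rule derivative_eq_intros D poly_DERIV refl)+
      (simp add: member_def ordinate_def pderiv_add pderiv_diff pderiv_smult algebra_simps power2_eq_square)
  moreover have "((\<lambda>x. (\<sigma> x)\<^sup>2 * poly K x + 2 * \<sigma> x * poly L x - poly W x) has_field_derivative 0) (at x)"
    by (rule has_field_derivative_transform_within_open [OF DERIV_const [of 0] V])
      (use \<sigma>(2) in \<open>simp add: member_def\<close>)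
  ultimately show ?thesis by (rule DERIV_unique)
qed

definition root_branch ::
  "complex set \<Rightarrow> (complex \<Rightarrow> complex) \<Rightarrow> complex set \<Rightarrow> (complex \<Rightarrow> complex) \<Rightarrow> bool" where
  "root_branch U Y N \<xi> \<longleftrightarrow> open N \<and> (\<forall>s\<in>N. \<xi> s \<in> U \<and> \<xi> s \<in> roots s \<and> poly (ordinate s) (\<xi> s) = Y (\<xi> s) \<and>
     (\<xi> has_field_derivative - 2 * Y (\<xi> s) / poly (pderiv (member s)) (\<xi> s)) (at s))"

lemma root_branchD:
  assumes "root_branch U Y N \<xi>"
  shows "open N" and "s \<in> N \<Longrightarrow> \<xi> s \<in> U" and "s \<in> N \<Longrightarrow> \<xi> s \<in> roots s"
    and "s \<in> N \<Longrightarrow> poly (ordinate s) (\<xi> s) = Y (\<xi> s)"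
    and "s \<in> N \<Longrightarrow> (\<xi> has_field_derivative - 2 * Y (\<xi> s) / poly (pderiv (member s)) (\<xi> s)) (at s)"
  using assms unfolding root_branch_def by blast+

lemma root_branch_subset: "root_branch U Y N \<xi> \<Longrightarrow> open N' \<Longrightarrow> N' \<subseteq> N \<Longrightarrow> root_branch U Y N' \<xi>"
  unfolding root_branch_def by blast

lemma root_branch_exists:
  assumes s0: "s0 \<notin> exceptional" and U: "open U" "z \<in> U"
    and Y: "Y holomorphic_on U" "\<And>x. x \<in> U \<Longrightarrow> (Y x)\<^sup>2 = poly f x" "\<And>x. x \<in> U \<Longrightarrow> Y x \<noteq> 0"
    and z: "z \<in> roots s0" "poly (ordinate s0) z = Y z"
  obtains N \<xi> where "root_branch U Y N \<xi>" "s0 \<in> N" "\<xi> s0 = z"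
proof -
  obtain V \<sigma> where V: "open V" "z \<in> V" "V \<subseteq> U" and \<sigma>: "\<sigma> holomorphic_on V" "\<sigma> z = s0"
    and param: "\<And>x. x \<in> V \<Longrightarrow> x \<in> roots (\<sigma> x) \<and> poly (ordinate (\<sigma> x)) x = Y x"
    using local_parameter [OF U Y(1,2) Y(3) [OF U(2)] z] by blast
  have deriv: "poly (pderiv (member (\<sigma> x))) x = - 2 * Y x * deriv \<sigma> x" if "x \<in> V" for x
    using parameter_derivative [OF V(1) that \<sigma>(1)] param that by (simp add: eq_neg_iff_add_eq_0)
  have "deriv \<sigma> z \<noteq> 0"
    using deriv [OF V(2)] s0 z(1) \<sigma>(2) by (auto simp: exceptional_def)
  then obtain q where q: "q > 0" "ball z q \<subseteq> V" "open (\<sigma> ` ball z q)" "inj_on \<sigma> (ball z q)"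
    using has_complex_derivative_locally_invertible [OF \<sigma>(1) V(2,1)] by blast
  have "\<sigma> holomorphic_on ball z q" using \<sigma>(1) q(2) by (rule holomorphic_on_subset)
  then obtain \<xi> where \<xi>: "\<xi> holomorphic_on \<sigma> ` ball z q"
    "\<And>x. x \<in> ball z q \<Longrightarrow> deriv \<sigma> x * deriv \<xi> (\<sigma> x) = 1" "\<And>x. x \<in> ball z q \<Longrightarrow> \<xi> (\<sigma> x) = x"
    using holomorphic_has_inverse [OF _ open_ball q(4)] by metis
  show thesis
  proof (rule that)
    show "root_branch U Y (\<sigma> ` ball z q) \<xi>"
      unfolding root_branch_def
    proof (intro conjI ballI q(3))
      fix s assume "s \<in> \<sigma> ` ball z q"
      then obtain x where x: "x \<in> ball z q" "s = \<sigma> x" by blast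
      then have xV: "x \<in> V" and \<xi>s: "\<xi> s = x" using q(2) \<xi>(3) by auto
      show "\<xi> s \<in> U" "\<xi> s \<in> roots s" "poly (ordinate s) (\<xi> s) = Y (\<xi> s)"
        using param [OF xV] xV V(3) \<xi>s x(2) by auto
      have "deriv \<xi> s = - 2 * Y x / poly (pderiv (member s)) x"
      proof -
        have "deriv \<sigma> x \<noteq> 0" "Y x \<noteq> 0" using \<xi>(2) [OF x(1)] Y(3) xV V(3) by auto
        then show ?thesis
          using \<xi>(2) [OF x(1)] unfolding x(2) deriv [OF xV] by (simp add: field_simps)
      qed
      moreover have "(\<xi> has_field_derivative deriv \<xi> s) (at s)"
        using \<xi>(1) q(3) \<open>s \<in> \<sigma> ` ball z q\<close> holomorphic_derivI by blast
      ultimately show "(\<xi> has_field_derivative - 2 * Y (\<xi> s) / poly (pderiv (member s)) (\<xi> s)) (at s)"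
        using \<xi>s by simp
    qed
    show "s0 \<in> \<sigma> ` ball z q" "\<xi> s0 = z"
      using q(1) \<sigma>(2) \<xi>(3) [of z] by (metis centre_in_ball imageI, simp)
  qed
qed

end

section \<open>Abel's theorem for a pencil of degree four divisors\<close>

definition fpoly :: "(nat \<Rightarrow> complex) \<Rightarrow> complex poly" where
  "fpoly a = (\<Sum>i\<le>8. monom (of_nat (8 choose i) * a i) i)"

lemma poly_fpoly: "poly (fpoly a) x = fC a x"
  by (simp add: fpoly_def fC_def poly_sum poly_monom)

lemma coeff_fpoly: "coeff (fpoly a) n = (if n \<le> 8 then of_nat (8 choose n) * a n else 0)"
  by (simp add: fpoly_def coeff_sum)

lemma poly_pderiv_fpoly: "poly (pderiv (fpoly a)) x = fC' a x"
proof -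
  have "poly (pderiv (fpoly a)) x = (\<Sum>i\<le>8. of_nat i * (of_nat (8 choose i) * a i) * x ^ (i - 1))"
    by (simp add: fpoly_def higher_pderiv_sum [where n = 1, simplified] poly_sum pderiv_monom poly_monom)
  also have "\<dots> = (\<Sum>i\<in>{1..8}. of_nat i * (of_nat (8 choose i) * a i) * x ^ (i - 1))"
    by (rule sum.mono_neutral_right) auto
  finally show ?thesis by (simp add: fC'_def mult_ac)
qed

lemma finite_disjoint_balls:
  fixes Z :: "'a::metric_space set"
  assumes "finite Z"
  shows "\<exists>d>0. \<forall>z\<in>Z. \<forall>w\<in>Z. z \<noteq> w \<longrightarrow> ball z d \<inter> ball w d = {}"
proof -
  obtain \<delta> where \<delta>: "\<And>z. \<delta> z > 0" "\<And>z w. w \<in> Z \<Longrightarrow> w \<noteq> z \<Longrightarrow> \<delta> z \<le> dist z w"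
    using finite_set_avoid [OF assms] by metis
  define d where "d = Min (insert 1 (\<delta> ` Z)) / 2"
  have d: "2 * d \<le> \<delta> z" if "z \<in> Z" for z
    using assms that by (simp add: d_def)
  have "ball z d \<inter> ball w d = {}" if "z \<in> Z" "w \<in> Z" "z \<noteq> w" for z w
    using d [OF that(1)] \<delta>(2) [of w z] that by (intro disjoint_ballI) auto
  moreover have "d > 0" using assms \<delta>(1) by (simp add: d_def)
  ultimately show ?thesis by blast
qed

locale octic_pencil = pencil "fpoly a" L K W for a L K W +
  assumes degree_W: "degree W = 4"
begin

lemma sum_du_roots:
  assumes "s \<notin> exceptional" "\<And>z. z \<in> roots s \<Longrightarrow> \<eta> z \<noteq> 0"
  shows "(\<Sum>z\<in>roots s. du z (\<eta> z) (c * \<eta> z / poly (pderiv (member s)) z * h)) = 0"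
proof -
  let ?m = "\<lambda>z. poly (pderiv (member s)) z"
  have power_sum: "(\<Sum>z\<in>roots s. h * c * (z ^ j / ?m z)) = 0" if "j \<le> 2" for j
  proof -
    have "(\<Sum>z\<in>roots s. poly (monom 1 j) z / ?m z) = 0"
      using assms(1) that by (intro sum_roots_poly_over_pderiv_eq_0 rsquarefree_member)
        (simp_all add: degree_monom_eq degree_member degree_W)
    then show ?thesis
      unfolding sum_distrib_left [symmetric] by (simp add: poly_monom)
  qed
  have "(\<Sum>z\<in>roots s. du z (\<eta> z) (c * \<eta> z / ?m z * h)) =
      (\<Sum>z\<in>roots s. (h * c * (z ^ 0 / ?m z), h * c * (z ^ 1 / ?m z), h * c * (z ^ 2 / ?m z)))"
    using assms(2) by (intro sum.cong) (auto simp: du_def)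
  also have "\<dots> = 0"
    using power_sum [of 0] power_sum [of 1] power_sum [of 2]
    by (simp add: prod_eq_iff fst_sum snd_sum del: power_0 power_one_right)
  finally show ?thesis .
qed

lemma root_abel_branch_exists:
  assumes "s \<notin> exceptional" "z \<in> roots s" "d > 0"
  shows "\<exists>U Y \<Phi> N \<xi>. U \<subseteq> ball z d \<and> abel_branch a U Y \<Phi> \<and> root_branch U Y N \<xi> \<and> s \<in> N"
proof -
  define y where "y = poly (ordinate s) z"
  have y: "y\<^sup>2 = fC a z" "y \<noteq> 0"
    using ordinate_square [OF assms(2)] assms(1,2) by (auto simp: y_def exceptional_def poly_fpoly)
  obtain r Y \<Phi> where r: "r > 0" "abel_branch a (ball z r) Y \<Phi>" "Y z = y"
    using abel_branch_exists [OF y] .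
  have br: "abel_branch a (ball z (min r d)) Y \<Phi>"
    using r(2) by (rule abel_branch_subset) auto
  obtain N \<xi> where rb: "root_branch (ball z (min r d)) Y N \<xi>" "s \<in> N"
  proof (rule root_branch_exists [OF assms(1) abel_branchD(1) [OF br] _ abel_branchD(3) [OF br] _ _ assms(2)])
    show "z \<in> ball z (min r d)" using r(1) assms(3) by simp
    show "(Y x)\<^sup>2 = poly (fpoly a) x" "Y x \<noteq> 0" if "x \<in> ball z (min r d)" for x
      using abel_branchD(4,5) [OF br that] by (simp_all add: poly_fpoly)
    show "poly (ordinate s) z = Y z" using r(3) by (simp add: y_def)
  qed
  have "ball z (min r d) \<subseteq> ball z d" by auto
  then show ?thesis by (intro exI conjI) (rule br rb | assumption)+
qed

text \<open>Distinct roots stay in disjoint disks, so that the branches through the roots of one member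
  account for all four roots of every nearby member.\<close>
lemma roots_parametrization:
  assumes s0: "s0 \<notin> exceptional"
  obtains e U Y \<Phi> \<xi> where "e > 0" "ball s0 e \<inter> exceptional = {}"
    "\<And>z. z \<in> roots s0 \<Longrightarrow> abel_branch a (U z) (Y z) (\<Phi> z)"
    "\<And>z. z \<in> roots s0 \<Longrightarrow> root_branch (U z) (Y z) (ball s0 e) (\<xi> z)"
    "\<And>s. s \<in> ball s0 e \<Longrightarrow> bij_betw (\<lambda>z. \<xi> z s) (roots s0) (roots s)"
proof -
  obtain d where d: "d > 0" "\<And>z w. z \<in> roots s0 \<Longrightarrow> w \<in> roots s0 \<Longrightarrow> z \<noteq> w \<Longrightarrow> ball z d \<inter> ball w d = {}"
    using finite_disjoint_balls [OF finite_roots] by metis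
  define chart where "chart z U Y \<Phi> N \<xi> \<longleftrightarrow>
    U \<subseteq> ball z d \<and> abel_branch a U Y \<Phi> \<and> root_branch U Y N \<xi> \<and> s0 \<in> N" for z U Y \<Phi> N \<xi>
  have "\<exists>U Y \<Phi> N \<xi>. chart z U Y \<Phi> N \<xi>" if "z \<in> roots s0" for z
    using root_abel_branch_exists [OF s0 that d(1)] by (simp add: chart_def)
  then obtain U Y \<Phi> N \<xi> where "\<And>z. z \<in> roots s0 \<Longrightarrow> chart z (U z) (Y z) (\<Phi> z) (N z) (\<xi> z)"
    by metis
  then have br: "abel_branch a (U z) (Y z) (\<Phi> z)" and U: "U z \<subseteq> ball z d"
    and rb: "root_branch (U z) (Y z) (N z) (\<xi> z)" "s0 \<in> N z" if "z \<in> roots s0" for z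
    using that by (simp_all add: chart_def)
  have "open ((\<Inter>z\<in>roots s0. N z) - exceptional)"
    using root_branchD(1) [OF rb(1)] finite_roots finite_exceptional
    by (intro open_Diff open_INT finite_imp_closed) auto
  then obtain e where e: "e > 0" "ball s0 e \<subseteq> (\<Inter>z\<in>roots s0. N z) - exceptional"
    using open_contains_ball s0 rb(2) by (metis DiffI INT_I)
  have rb': "root_branch (U z) (Y z) (ball s0 e) (\<xi> z)" if "z \<in> roots s0" for z
    using root_branch_subset [OF rb(1) [OF that] open_ball] e(2) that by blast
  have "bij_betw (\<lambda>z. \<xi> z s) (roots s0) (roots s)" if s: "s \<in> ball s0 e" for s
  proof -
    have sep: "\<xi> z s \<in> ball z d" if "z \<in> roots s0" for z
      using root_branchD(2) [OF rb' [OF that] s] U [OF that] by blast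
    have inj: "inj_on (\<lambda>z. \<xi> z s) (roots s0)"
      using sep d(2) by (intro inj_onI) (metis IntI empty_iff)
    moreover have "(\<lambda>z. \<xi> z s) ` roots s0 = roots s"
    proof (rule card_subset_eq [OF finite_roots])
      show "(\<lambda>z. \<xi> z s) ` roots s0 \<subseteq> roots s"
        using root_branchD(3) [OF rb' s] by blast
      have "s \<notin> exceptional" using e(2) s by blast
      then show "card ((\<lambda>z. \<xi> z s) ` roots s0) = card (roots s)"
        using card_image [OF inj] card_roots s0 by simp
    qed
    ultimately show ?thesis by (simp add: bij_betw_def)
  qed
  moreover have "ball s0 e \<inter> exceptional = {}" using e(2) by blast
  ultimately show thesis using that [of e U Y \<Phi> \<xi>] e(1) br rb' by blast
qed

lemma sum_branches_constant:
  assumes disj: "ball s0 e \<inter> exceptional = {}"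
    and br: "\<And>z. z \<in> roots s0 \<Longrightarrow> abel_branch a (U z) (Y z) (\<Phi> z)"
    and rb: "\<And>z. z \<in> roots s0 \<Longrightarrow> root_branch (U z) (Y z) (ball s0 e) (\<xi> z)"
    and bij: "\<And>s. s \<in> ball s0 e \<Longrightarrow> bij_betw (\<lambda>z. \<xi> z s) (roots s0) (roots s)"
    and st: "s \<in> ball s0 e" "t \<in> ball s0 e"
  shows "(\<Sum>z\<in>roots s0. \<Phi> z (\<xi> z s)) = (\<Sum>z\<in>roots s0. \<Phi> z (\<xi> z t))"
proof (rule has_derivative_zero_unique [OF convex_ball _ st])
  fix r assume r: "r \<in> ball s0 e"
  let ?m = "\<lambda>z. poly (pderiv (member r)) z"
  have in_U: "\<xi> z r \<in> U z" and ord: "poly (ordinate r) (\<xi> z r) = Y z (\<xi> z r)"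
    and der: "(\<xi> z has_derivative (*) (- 2 * Y z (\<xi> z r) / ?m (\<xi> z r))) (at r)"
    if "z \<in> roots s0" for z
    using root_branchD(2,4,5) [OF rb [OF that] r]
    unfolding has_field_derivative_def by blast+
  have "((\<lambda>s. \<Sum>z\<in>roots s0. \<Phi> z (\<xi> z s)) has_derivative
      (\<lambda>h. \<Sum>z\<in>roots s0. du (\<xi> z r) (Y z (\<xi> z r)) (- 2 * Y z (\<xi> z r) / ?m (\<xi> z r) * h))) (at r)"
    by (intro has_derivative_sum has_derivative_compose [OF der abel_branchD(6) [OF br in_U]])
  moreover have "(\<Sum>z\<in>roots s0. du (\<xi> z r) (Y z (\<xi> z r)) (- 2 * Y z (\<xi> z r) / ?m (\<xi> z r) * h)) = 0" for h
  proof -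
    have "(\<Sum>z\<in>roots s0. du (\<xi> z r) (Y z (\<xi> z r)) (- 2 * Y z (\<xi> z r) / ?m (\<xi> z r) * h)) =
        (\<Sum>w\<in>roots r. du w (poly (ordinate r) w) (- 2 * poly (ordinate r) w / ?m w * h))"
      using sum.reindex_bij_betw [OF bij [OF r],
          of "\<lambda>w. du w (poly (ordinate r) w) (- 2 * poly (ordinate r) w / ?m w * h)"]
      by (simp add: ord)
    also have "\<dots> = 0"
    proof (rule sum_du_roots)
      show "r \<notin> exceptional" using disj r by blast
      then show "poly (ordinate r) w \<noteq> 0" if "w \<in> roots r" for w
        using ordinate_square [OF that] that by (auto simp: exceptional_def)
    qed
    finally show ?thesis .
  qed
  ultimately show "((\<lambda>s. \<Sum>z\<in>roots s0. \<Phi> z (\<xi> z s)) has_derivative (\<lambda>h. 0)) (at r within ball s0 e)"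
    by (simp add: has_derivative_at_withinI)
qed

lemma abel_sum_roots_locally_constant:
  assumes "s0 \<notin> exceptional"
  shows "\<exists>e>0. \<forall>s\<in>ball s0 e.
    abel_sum a P (roots s) (poly (ordinate s)) u \<longleftrightarrow> abel_sum a P (roots s0) (poly (ordinate s0)) u"
proof -
  obtain e U Y \<Phi> \<xi> where e: "e > 0" "ball s0 e \<inter> exceptional = {}"
    and br: "\<And>z. z \<in> roots s0 \<Longrightarrow> abel_branch a (U z) (Y z) (\<Phi> z)"
    and rb: "\<And>z. z \<in> roots s0 \<Longrightarrow> root_branch (U z) (Y z) (ball s0 e) (\<xi> z)"
    and bij: "\<And>s. s \<in> ball s0 e \<Longrightarrow> bij_betw (\<lambda>z. \<xi> z s) (roots s0) (roots s)"
    using roots_parametrization [OF assms] by blast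
  have on_branch: "\<xi> z s \<in> U z" "poly (ordinate s) (\<xi> z s) = Y z (\<xi> z s)"
    if "s \<in> ball s0 e" "z \<in> roots s0" for s z
    using root_branchD(2,4) [OF rb [OF that(2)] that(1)] .
  have transport: "abel_sum a P (roots t) (poly (ordinate t)) u"
    if st: "s \<in> ball s0 e" "t \<in> ball s0 e" and sum: "abel_sum a P (roots s) (poly (ordinate s)) u" for s t
  proof -
    have inj: "inj_on (\<lambda>z. \<xi> z r) (roots s0)" and img: "(\<lambda>z. \<xi> z r) ` roots s0 = roots r"
      if "r \<in> ball s0 e" for r
      using bij [OF that] by (auto simp: bij_betw_def)
    have "abel_sum a P (roots t) (poly (ordinate t))
        (u + (\<Sum>z\<in>roots s0. \<Phi> z (\<xi> z t) - \<Phi> z (\<xi> z s)))"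
      unfolding img [OF st(2), symmetric]
      by (rule abel_sum_transport [where \<eta> = "poly (ordinate s)",
            OF inj [OF st(1)] on_branch [OF st(1)] inj [OF st(2)] on_branch [OF st(2)] br])
        (simp_all add: img [OF st(1)] sum)
    moreover have "(\<Sum>z\<in>roots s0. \<Phi> z (\<xi> z t) - \<Phi> z (\<xi> z s)) = 0"
      using sum_branches_constant [OF e(2) br rb bij st] by (simp add: sum_subtractf)
    ultimately show ?thesis by simp
  qed
  have "s0 \<in> ball s0 e" using e(1) by simp
  then show ?thesis using e(1) transport by blast
qed

lemma abel_sum_roots_independent:
  assumes "s \<notin> exceptional" "t \<notin> exceptional" "abel_sum a P (roots s) (poly (ordinate s)) u"
  shows "abel_sum a P (roots t) (poly (ordinate t)) u"
proof -
  let ?sums_to_u = "\<lambda>s. abel_sum a P (roots s) (poly (ordinate s)) u"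
  have "?sums_to_u constant_on (- exceptional)"
  proof (rule locally_constant_imp_constant)
    show "connected (- exceptional)"
      unfolding Compl_eq_Diff_UNIV using finite_exceptional
      by (intro connected_open_delete_finite) auto
    fix s assume s: "s \<in> - exceptional"
    then obtain e where e: "e > 0" "\<forall>t\<in>ball s e. ?sums_to_u t = ?sums_to_u s"
      using abel_sum_roots_locally_constant [of s P u] by blast
    have "openin (top_of_set (- exceptional)) (- exceptional \<inter> ball s e)"
      by (intro openin_open_Int open_ball)
    moreover have "s \<in> - exceptional \<inter> ball s e"
      using s e(1) by simp
    ultimately show "\<exists>T. openin (top_of_set (- exceptional)) T \<and> s \<in> T \<and> (\<forall>t\<in>T. ?sums_to_u t = ?sums_to_u s)"
      using e(2) by blast
  qed
  with assms show ?thesis unfolding constant_on_def by auto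
qed

lemma abel_sum_through_generic_point:
  assumes u: "abel_sum a P (roots s0) (poly (ordinate s0)) u" "s0 \<notin> exceptional"
    and br: "abel_branch a U Y \<Phi>"
  obtains B where "finite B" "\<And>z. z \<in> U - B \<Longrightarrow> \<exists>s. s \<notin> exceptional \<and> z \<in> roots s \<and>
    poly (ordinate s) z = Y z \<and> abel_sum a P (roots s) (poly (ordinate s)) u"
proof
  define B where "B = {x. poly K x = 0} \<union> (\<Union>s\<in>exceptional. roots s)"
  have "K \<noteq> 0" using degree_K degree_W by auto
  then show "finite B"
    unfolding B_def using finite_exceptional finite_roots poly_roots_finite by blast
  fix z assume z: "z \<in> U - B"
  then have K: "poly K z \<noteq> 0" by (simp add: B_def)
  define s where "s = (Y z - poly L z) / poly K z"
  have "(Y z)\<^sup>2 = poly (fpoly a) z"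
    using abel_branchD(4) [OF br] z by (simp add: poly_fpoly)
  from on_member_via_K [OF this K, of s] have s: "z \<in> roots s" "poly (ordinate s) z = Y z"
    using K by (simp_all add: s_def)
  then have "s \<notin> exceptional" using z by (auto simp: B_def)
  with s u show "\<exists>s. s \<notin> exceptional \<and> z \<in> roots s \<and> poly (ordinate s) z = Y z \<and>
      abel_sum a P (roots s) (poly (ordinate s)) u"
    using abel_sum_roots_independent by blast
qed

end

section \<open>Density of sums of four Abelian integrals\<close>

locale octic_curve =
  fixes a :: "nat \<Rightarrow> complex"
  assumes lead_nonzero: "a 8 \<noteq> 0"
    and nonsingular: "\<And>x. fC a x = 0 \<Longrightarrow> fC' a x \<noteq> 0"
begin

lemma degree_fpoly: "degree (fpoly a) = 8"
  using lead_nonzero by (intro antisym degree_le le_degree) (auto simp: coeff_fpoly)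

lemma rsquarefree_fpoly: "rsquarefree (fpoly a)"
  using nonsingular unfolding rsquarefree_roots by (auto simp: poly_fpoly poly_pderiv_fpoly)

lemma finite_branch_points: "finite {x. fC a x = 0}"
proof -
  have "fpoly a \<noteq> 0" using degree_fpoly by auto
  from poly_roots_finite [OF this] show ?thesis by (simp add: poly_fpoly)
qed

lemma octic_pencil_through:
  assumes "card Z = 4" "\<And>z. z \<in> Z \<Longrightarrow> (\<eta> z)\<^sup>2 = fC a z"
  obtains L K where "octic_pencil a L K (root_poly Z)" "\<forall>z\<in>Z. poly L z = \<eta> z"
proof (rule interpolation_factorization)
  show "finite Z" "Z \<noteq> {}" using assms(1) card.infinite by fastforce+
  show "degree (fpoly a) = 2 * card Z" by (simp add: degree_fpoly assms(1))
  show "(\<eta> z)\<^sup>2 = poly (fpoly a) z" if "z \<in> Z" for z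
    using assms(2) [OF that] by (simp add: poly_fpoly)
  fix L K
  assume "fpoly a = L\<^sup>2 + K * root_poly Z" "degree L < card Z" "degree K = card Z"
    and L: "\<forall>z\<in>Z. poly L z = \<eta> z"
  then have "octic_pencil a L K (root_poly Z)"
    using assms(1) rsquarefree_fpoly by unfold_locales auto
  with L show thesis by (rule that [rotated])
qed

end

definition abel_sums :: "(nat \<Rightarrow> complex) \<Rightarrow> complex \<times> complex \<Rightarrow> nat \<Rightarrow> cvec3 set" where
  "abel_sums a P n = {u. \<exists>Z \<eta>. card Z = n \<and> abel_sum a P Z \<eta> u}"

lemma abel_sumsI: "abel_sum a P Z \<eta> u \<Longrightarrow> u \<in> abel_sums a P (card Z)"
  unfolding abel_sums_def by blast

lemma continuous_on_in_closed_cofinite: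
  fixes g :: "'a::{t1_space, perfect_space} \<Rightarrow> 'b::topological_space"
  assumes g: "continuous_on U g" "open U" "w \<in> U" and "closed C" "finite F" "\<And>z. z \<in> U - F \<Longrightarrow> g z \<in> C"
  shows "g w \<in> C"
proof (rule Lim_in_closed_set [OF \<open>closed C\<close>])
  show "(g \<longlongrightarrow> g w) (at w)"
    using g by (metis at_within_open continuous_on_def)
  have "open (U - (F - {w}))" "w \<in> U - (F - {w})"
    using g(2,3) \<open>finite F\<close> by (auto intro: open_Diff finite_imp_closed)
  then have "\<forall>\<^sub>F z in at w. z \<in> U - (F - {w})" by (rule eventually_at_in_open')
  moreover have "\<forall>\<^sub>F z in at w. z \<noteq> w" by (simp add: eventually_at_filter)
  ultimately show "\<forall>\<^sub>F z in at w. g z \<in> C"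
    by eventually_elim (use assms(6) in auto)
qed simp

lemma continuous_on_open_eq_0_if_dense:
  fixes f :: "'a::topological_space \<Rightarrow> 'b::{t1_space, zero}"
  assumes "continuous_on D f" "open D" "closure S = UNIV" "\<And>x. x \<in> S \<inter> D \<Longrightarrow> f x = 0" "x \<in> D"
  shows "f x = 0"
proof (rule ccontr)
  assume "f x \<noteq> 0"
  have "open (D \<inter> f -` (- {0}))"
    using assms(1,2) by (intro continuous_open_preimage) auto
  moreover have "x \<in> D \<inter> f -` (- {0})" using \<open>f x \<noteq> 0\<close> assms(5) by simp
  ultimately have "D \<inter> f -` (- {0}) \<inter> S \<noteq> {}"
    using open_Int_closure_eq_empty [of "D \<inter> f -` (- {0})" S] unfolding assms(3) by auto
  then show False using assms(4) by auto
qed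

lemma abel_branch_continuous_on: "abel_branch a U Y \<Phi> \<Longrightarrow> continuous_on U \<Phi>"
  by (simp add: abel_branch_isCont continuous_at_imp_continuous_on)

lemma abel_sum_move_point_in_closure:
  assumes sum: "abel_sum a P Z \<eta> u" "finite Z" and z: "z \<in> Z" "Y z = \<eta> z"
    and br: "abel_branch a U Y \<Phi>" "z \<in> U" "w \<in> U"
  shows "u + (\<Phi> w - \<Phi> z) \<in> closure (abel_sums a P (card Z))"
proof (rule continuous_on_in_closed_cofinite [where g = "\<lambda>w. u + (\<Phi> w - \<Phi> z)" and F = "Z - {z}"])
  show "continuous_on U (\<lambda>w. u + (\<Phi> w - \<Phi> z))"
    by (intro continuous_intros abel_branch_continuous_on [OF br(1)])
  show "u + (\<Phi> x - \<Phi> z) \<in> closure (abel_sums a P (card Z))" if x: "x \<in> U - (Z - {z})" for x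
  proof -
    have "abel_sum a P (insert x (Z - {z})) (\<eta>(x := Y x)) (u + (\<Phi> x - \<Phi> z))"
      using x by (intro abel_sum_move_point [OF sum z _ br(1,2)]) auto
    moreover have "card (insert x (Z - {z})) = card Z"
      using x by (intro card_insert_remove_other sum(2) z(1)) blast
    ultimately have "u + (\<Phi> x - \<Phi> z) \<in> abel_sums a P (card Z)"
      using abel_sumsI by metis
    then show ?thesis by (rule subsetD [OF closure_subset])
  qed
qed (use abel_branchD(1) [OF br(1)] br(3) sum(2) in auto)

text \<open>The sum \<open>u\<close> is also attained on a member of the pencil through the given point of the branch, and on
  that member the point can be moved along the branch.\<close>
lemma (in octic_curve) abel_sums_translate:
  assumes u: "u \<in> abel_sums a P 4" and br: "abel_branch a U Y \<Phi>" and zw: "z0 \<in> U" "w0 \<in> U"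
  shows "u + (\<Phi> w0 - \<Phi> z0) \<in> closure (abel_sums a P 4)"
proof -
  obtain Z \<eta> where Z: "card Z = 4" and sum: "abel_sum a P Z \<eta> u"
    using u unfolding abel_sums_def by blast
  have fin: "finite Z" using Z card.infinite by fastforce
  obtain L K where pencil: "octic_pencil a L K (root_poly Z)" and L: "\<forall>z\<in>Z. poly L z = \<eta> z"
    using octic_pencil_through [OF Z, of \<eta>] abel_sum_on_curve [OF sum] by blast
  interpret octic_pencil a L K "root_poly Z" by (rule pencil)
  have roots_0: "roots 0 = Z"
    using poly_root_poly_eq_0_iff [OF fin] by (auto simp: member_def)
  have "fC a z \<noteq> 0" if "z \<in> Z" for z using abel_sum_on_curve [OF sum that] by auto
  then have nonexc: "0 \<notin> exceptional"
    using poly_pderiv_root_poly_nonzero [OF fin]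
    by (auto simp: exceptional_def member_def pderiv_minus poly_fpoly poly_root_poly_eq_0_iff [OF fin])
  have "abel_sum a P (roots 0) (poly (ordinate 0)) u"
    unfolding roots_0 using sum L by (simp add: abel_sum_def ordinate_def)
  from abel_sum_through_generic_point [OF this nonexc br]
  obtain B where B: "finite B" "\<And>z. z \<in> U - B \<Longrightarrow> \<exists>s. s \<notin> exceptional \<and> z \<in> roots s \<and>
      poly (ordinate s) z = Y z \<and> abel_sum a P (roots s) (poly (ordinate s)) u"
    by blast
  show ?thesis
  proof (rule continuous_on_in_closed_cofinite [where g = "\<lambda>z. u + (\<Phi> w0 - \<Phi> z)", OF _ _ zw(1) _ B(1)])
    show "continuous_on U (\<lambda>z. u + (\<Phi> w0 - \<Phi> z))"
      by (intro continuous_intros abel_branch_continuous_on [OF br])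
    fix z assume z: "z \<in> U - B"
    from B(2) [OF this] obtain s where s: "s \<notin> exceptional" "z \<in> roots s" "Y z = poly (ordinate s) z"
        "abel_sum a P (roots s) (poly (ordinate s)) u"
      by metis
    from abel_sum_move_point_in_closure [OF s(4) finite_roots s(2,3) br _ zw(2)] z
    show "u + (\<Phi> w0 - \<Phi> z) \<in> closure (abel_sums a P 4)"
      by (simp add: card_roots [OF s(1)] Z)
  qed (use abel_branchD(1) [OF br] in auto)
qed

definition translation_monoid :: "'a::real_normed_vector set \<Rightarrow> 'a set" where
  "translation_monoid X = {v. \<forall>u\<in>X. u + v \<in> X}"

lemma translation_monoid_0: "0 \<in> translation_monoid X"
  by (simp add: translation_monoid_def)

lemma translation_monoid_add: "v \<in> translation_monoid X \<Longrightarrow> w \<in> translation_monoid X \<Longrightarrow> v + w \<in> translation_monoid X"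
  by (auto simp: translation_monoid_def simp flip: add.assoc)

lemma closed_translation_monoid: "closed X \<Longrightarrow> closed (translation_monoid X)"
proof -
  assume "closed X"
  moreover have "translation_monoid X = (\<Inter>u\<in>X. (\<lambda>v. u + v) -` X)"
    by (auto simp: translation_monoid_def)
  ultimately show ?thesis
    by (auto intro!: closed_INT closed_vimage continuous_intros)
qed

lemma translation_monoid_closureI:
  assumes "\<And>u. u \<in> S \<Longrightarrow> u + v \<in> closure S"
  shows "v \<in> translation_monoid (closure S)"
proof -
  have "closure S \<subseteq> (\<lambda>u. u + v) -` closure S"
    using assms by (intro closure_minimal closed_vimage continuous_intros) auto
  then show ?thesis by (auto simp: translation_monoid_def)
qed

lemma derivative_in_closed_monoid:
  fixes f :: "'a::real_normed_vector \<Rightarrow> 'b::real_normed_vector"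
  assumes "closed G" "0 \<in> G" and plus: "\<And>v w. v \<in> G \<Longrightarrow> w \<in> G \<Longrightarrow> v + w \<in> G"
    and f: "(f has_derivative f') (at x)" and ev: "\<forall>\<^sub>F w in nhds x. f w - f x \<in> G"
  shows "f' h \<in> G"
proof -
  have mult: "real n *\<^sub>R v \<in> G" if "v \<in> G" for n v
    by (induction n) (use that assms(2) plus in \<open>auto simp: scaleR_left_distrib\<close>)
  define \<epsilon> where "\<epsilon> n = inverse (real (Suc n))" for n
  have \<epsilon>: "filterlim \<epsilon> (at 0) sequentially"
    unfolding \<epsilon>_def [abs_def] filterlim_at using LIMSEQ_inverse_real_of_nat by auto
  have "((\<lambda>t. x + t *\<^sub>R h) has_derivative (\<lambda>t. t *\<^sub>R h)) (at 0)"
    by (auto intro!: derivative_eq_intros)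
  then have "((\<lambda>t. f (x + t *\<^sub>R h)) has_derivative (\<lambda>t. t *\<^sub>R f' h)) (at 0)"
    using has_derivative_compose [of "\<lambda>t. x + t *\<^sub>R h" "\<lambda>t. t *\<^sub>R h" 0 UNIV f f'] f
    by (simp add: linear_scale has_derivative_linear [OF f])
  then have "((\<lambda>t. inverse (norm t) *\<^sub>R (f (x + t *\<^sub>R h) - f x - t *\<^sub>R f' h)) \<longlongrightarrow> 0) (at 0)"
    by (simp add: has_derivative_def)
  from filterlim_compose [OF this \<epsilon>]
  have "(\<lambda>n. inverse (\<epsilon> n) *\<^sub>R (f (x + \<epsilon> n *\<^sub>R h) - f x) - f' h) \<longlonglongrightarrow> 0"
    by (simp add: \<epsilon>_def scaleR_diff_right)
  then have lim: "(\<lambda>n. real (Suc n) *\<^sub>R (f (x + \<epsilon> n *\<^sub>R h) - f x)) \<longlonglongrightarrow> f' h"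
    by (simp add: LIM_zero_iff \<epsilon>_def)
  have "(\<lambda>n. x + \<epsilon> n *\<^sub>R h) \<longlonglongrightarrow> x + 0 *\<^sub>R h"
    unfolding \<epsilon>_def by (intro tendsto_intros LIMSEQ_inverse_real_of_nat)
  then have "\<forall>\<^sub>F n in sequentially. f (x + \<epsilon> n *\<^sub>R h) - f x \<in> G"
    using eventually_compose_filterlim [OF ev] by simp
  then have "\<forall>\<^sub>F n in sequentially. real (Suc n) *\<^sub>R (f (x + \<epsilon> n *\<^sub>R h) - f x) \<in> G"
    by eventually_elim (rule mult)
  from Lim_in_closed_set [OF \<open>closed G\<close> this _ lim] show ?thesis by simp
qed

lemma du_in_closed_monoid:
  assumes "closed G" "0 \<in> G" "\<And>v w. v \<in> G \<Longrightarrow> w \<in> G \<Longrightarrow> v + w \<in> G"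
    and G: "\<And>U Y \<Phi> z w. abel_branch a U Y \<Phi> \<Longrightarrow> z \<in> U \<Longrightarrow> w \<in> U \<Longrightarrow> \<Phi> w - \<Phi> z \<in> G"
    and x: "fC a x \<noteq> 0"
  shows "du x 1 h \<in> G"
proof -
  define y where "y = csqrt (fC a x)"
  have y: "y\<^sup>2 = fC a x" "y \<noteq> 0" using x by (auto simp: y_def)
  obtain r Y \<Phi> where r: "r > 0" and br: "abel_branch a (ball x r) Y \<Phi>" and Yx: "Y x = y"
    using abel_branch_exists [OF y] .
  have "(\<Phi> has_derivative du x y) (at x)"
    using abel_branchD(6) [OF br, of x] r Yx by simp
  moreover have "\<forall>\<^sub>F w in nhds x. \<Phi> w - \<Phi> x \<in> G"
    using eventually_nhds_in_open [of "ball x r" x] r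
    by (auto elim!: eventually_mono intro!: G [OF br])
  ultimately have "du x y (h * y) \<in> G"
    using derivative_in_closed_monoid [OF assms(1-3)] by blast
  then show ?thesis using y(2) by (simp add: du_def)
qed

lemma (in octic_curve) closure_abel_sums:
  assumes base: "y0\<^sup>2 = fC a x0" "y0 \<noteq> 0"
  shows "closure (abel_sums a (x0, y0) 4) = UNIV"
proof -
  define X where "X = closure (abel_sums a (x0, y0) 4)"
  have closed_G: "closed (translation_monoid X)"
    by (simp add: X_def closed_translation_monoid)
  have branch: "\<Phi> w - \<Phi> z \<in> translation_monoid X" if "abel_branch a U Y \<Phi>" "z \<in> U" "w \<in> U" for U Y \<Phi> z w
    unfolding X_def by (intro translation_monoid_closureI abel_sums_translate [OF _ that])
  have du: "du x 1 h \<in> translation_monoid X" for x h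
  proof (rule continuous_on_in_closed_cofinite [where g = "\<lambda>x. du x 1 h", OF _ open_UNIV UNIV_I closed_G finite_branch_points])
    show "du x 1 h \<in> translation_monoid X" if "x \<in> UNIV - {x. fC a x = 0}" for x
      using du_in_closed_monoid [OF closed_G translation_monoid_0 translation_monoid_add branch] that by simp
  qed (auto simp: du_def intro!: continuous_intros)
  have all: "v \<in> translation_monoid X" for v
  proof -
    obtain p q r where "v = (p, q, r)" by (cases v)
    then have "v = du 0 1 (p - r) + du 1 1 ((r + q) / 2) + du (- 1) 1 ((r - q) / 2)"
      by (simp add: du_def field_simps)
    then show ?thesis by (simp only: translation_monoid_add du)
  qed
  obtain r Y \<Phi> where r: "r > 0" and br: "abel_branch a (ball x0 r) Y \<Phi>" and Y0: "Y x0 = y0"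
    using abel_branch_exists [OF base] .
  have "infinite (ball x0 r)" using r uncountable_ball uncountable_infinite by blast
  then obtain Z where Z: "card Z = 4" "Z \<subseteq> ball x0 r"
    using infinite_arbitrarily_large by metis
  have "abel_value a (x0, y0) (z, Y z) (\<Phi> z - \<Phi> x0)" if "z \<in> Z" for z
    using abel_value_extend [where v = 0, OF _ br, of "(x0, y0)" x0 z] abel_value_refl [OF base] Y0 r Z(2) that
    by auto
  then have "abel_sum a (x0, y0) Z Y (\<Sum>z\<in>Z. \<Phi> z - \<Phi> x0)"
    unfolding abel_sum_def by (intro exI [of _ "\<lambda>z. \<Phi> z - \<Phi> x0"]) simp
  from abel_sumsI [OF this] obtain u where "u \<in> X"
    unfolding X_def Z(1) using subsetD [OF closure_subset] by blast
  then have "u + (v - u) \<in> X" for v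
    using all [of "v - u"] by (auto simp: translation_monoid_def)
  then show ?thesis unfolding X_def by auto
qed

section \<open>The algebra of \<open>h\<close> and \<open>A\<close>\<close>

lemma less_5_cases: "(m :: nat) < 5 \<Longrightarrow> m = 0 \<or> m = 1 \<or> m = 2 \<or> m = 3 \<or> m = 4"
  by linarith

lemma sum_lessThan_3: "(\<Sum>i<(3::nat). f i) = f 0 + f 1 + (f 2 :: 'a::comm_monoid_add)"
  by (simp add: eval_nat_numeral)

lemma sum_lessThan_5: "(\<Sum>i<(5::nat). f i) = f 0 + f 1 + f 2 + f 3 + (f 4 :: 'a::comm_monoid_add)"
  by (simp add: eval_nat_numeral add.assoc)

definition wp_form :: "(nat \<Rightarrow> nat \<Rightarrow> complex) \<Rightarrow> complex \<Rightarrow> complex \<Rightarrow> complex" where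
  "wp_form p x y = (\<Sum>i<3. \<Sum>j<3. p (Suc i) (Suc j) * x ^ i * y ^ j)"

definition wp_symmetric :: "(nat \<Rightarrow> nat \<Rightarrow> 'a) \<Rightarrow> bool" where
  "wp_symmetric p \<longleftrightarrow> (\<forall>i\<in>{1,2,3}. \<forall>j\<in>{1,2,3}. p i j = p j i)"

lemma wp_symmetricD: "wp_symmetric p \<Longrightarrow> i \<in> {1,2,3} \<Longrightarrow> j \<in> {1,2,3} \<Longrightarrow> p i j = p j i"
  by (simp only: wp_symmetric_def)

lemma wp_symmetric_lower:
  assumes "wp_symmetric p"
  shows "p 2 (Suc 0) = p (Suc 0) 2 \<and> p 3 (Suc 0) = p (Suc 0) 3 \<and> p 3 2 = p 2 3"
  using wp_symmetricD [OF assms, of 2 1] wp_symmetricD [OF assms, of 3 1] wp_symmetricD [OF assms, of 3 2] by simp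

lemma wp_form_diff: "wp_form (\<lambda>i j. p i j - p' i j) x y = wp_form p x y - wp_form p' x y"
  by (simp add: wp_form_def algebra_simps sum_subtractf)

lemma wp_form_divide: "wp_form (\<lambda>i j. p i j / c) x y = wp_form p x y / c"
  by (simp add: wp_form_def sum_divide_distrib)

lemma wp_form_commute: "wp_symmetric p \<Longrightarrow> wp_form p x y = wp_form p y x"
  by (simp add: wp_form_def sum_lessThan_3 numeral_2_eq_2 [symmetric] wp_symmetric_lower algebra_simps)

lemma hform_hmat_diff:
  assumes "wp_symmetric p" "wp_symmetric p'"
  shows "hform (hmat a p) x y - hform (hmat a p') x y = - 2 * (x - y)\<^sup>2 * (wp_form p x y - wp_form p' x y)"
  unfolding hform_def sum_lessThan_5 hmat_def wp_form_def sum_lessThan_3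
  by (simp add: numeral_2_eq_2 [symmetric] numeral_3_eq_3 [symmetric] assms [THEN wp_symmetric_lower]) algebra

lemma power_sum_eq_0_imp_coeff_eq_0:
  fixes c :: "nat \<Rightarrow> 'a::idom"
  assumes "n \<le> card S" "\<And>x. x \<in> S \<Longrightarrow> (\<Sum>i<n. c i * x ^ i) = 0" "k < n"
  shows "c k = 0"
proof -
  define p where "p = (\<Sum>i<n. monom (c i) i)"
  have "p = 0"
  proof (rule poly_eqI_degree [where A = S])
    show "poly p x = poly 0 x" if "x \<in> S" for x
      using assms(2) [OF that] by (simp add: p_def poly_sum poly_monom)
    have "degree p < n"
      unfolding p_def using assms(3) by (intro degree_sum_less) (auto intro: le_less_trans [OF degree_monom_le])
    then show "degree p < card S" using assms(1) by linarith
  qed (use assms in simp)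
  moreover have "coeff p k = c k"
    using assms(3) by (simp add: p_def coeff_sum)
  ultimately show ?thesis by simp
qed

lemma wp_form_eq_0_imp_eq_0:
  assumes Z: "card Z = 4" and zero: "\<And>z w. z \<in> Z \<Longrightarrow> w \<in> Z \<Longrightarrow> z \<noteq> w \<Longrightarrow> wp_form p z w = 0"
    and ij: "i \<in> {1,2,3}" "j \<in> {1,2,3}"
  shows "p i j = 0"
proof -
  have row: "(\<Sum>i<3. p (Suc i) (Suc l) * z ^ i) = 0" if z: "z \<in> Z" and "l < 3" for z l
  proof (rule power_sum_eq_0_imp_coeff_eq_0 [where S = "Z - {z}" and k = l and n = 3])
    show "3 \<le> card (Z - {z})" using Z z by simp
    show "(\<Sum>j<3. (\<Sum>i<3. p (Suc i) (Suc j) * z ^ i) * w ^ j) = 0" if "w \<in> Z - {z}" for w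
    proof -
      have "wp_form p z w = (\<Sum>j<3. (\<Sum>i<3. p (Suc i) (Suc j) * z ^ i) * w ^ j)"
        unfolding wp_form_def by (subst sum.swap) (simp add: sum_distrib_right)
      then show ?thesis using zero [of z w] z that by auto
    qed
  qed (fact that)
  have "p (Suc (i - 1)) (Suc (j - 1)) = 0"
    by (rule power_sum_eq_0_imp_coeff_eq_0 [where S = Z and n = 3 and c = "\<lambda>k. p (Suc k) (Suc (j - 1))"])
      (use Z row [of _ "j - 1"] ij in auto)
  moreover have "Suc (i - 1) = i" "Suc (j - 1) = j" using ij by auto
  ultimately show ?thesis by simp
qed

lemma poly_eq_sum_lessThan:
  fixes p :: "'a::comm_semiring_1 poly"
  assumes "degree p < n"
  shows "poly p x = (\<Sum>i<n. coeff p i * x ^ i)"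
  unfolding poly_altdef using assms
  by (intro sum.mono_neutral_left) (auto simp: coeff_eq_0)

definition rank3_matrix :: "complex poly \<Rightarrow> complex poly \<Rightarrow> complex poly \<Rightarrow> nat \<Rightarrow> nat \<Rightarrow> complex" where
  "rank3_matrix L K W i j = coeff L i * coeff L j + (coeff K i * coeff W j + coeff W i * coeff K j) / 2"

lemma hform_rank3_matrix:
  assumes "degree L < 5" "degree K < 5" "degree W < 5"
  shows "hform (rank3_matrix L K W) x y = poly L x * poly L y + (poly K x * poly W y + poly W x * poly K y) / 2"
  unfolding hform_def rank3_matrix_def assms [THEN poly_eq_sum_lessThan] sum_product
  by (simp add: sum.distrib add_divide_distrib sum_divide_distrib algebra_simps)

lemma fC_eq_poly: "fC a x = poly [:a 0, 8 * a 1, 28 * a 2, 56 * a 3, 70 * a 4, 56 * a 5, 28 * a 6, 8 * a 7, a 8:] x"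
  by (simp add: fC_def eval_nat_numeral algebra_simps)

definition antidiagonal_poly :: "(nat \<Rightarrow> nat \<Rightarrow> complex) \<Rightarrow> complex poly" where
  "antidiagonal_poly H = [:H 0 0, H 0 1 + H 1 0, H 0 2 + H 1 1 + H 2 0, H 0 3 + H 1 2 + H 2 1 + H 3 0,
    H 0 4 + H 1 3 + H 2 2 + H 3 1 + H 4 0, H 1 4 + H 2 3 + H 3 2 + H 4 1, H 2 4 + H 3 3 + H 4 2,
    H 3 4 + H 4 3, H 4 4:]"

lemma hform_diagonal: "hform H x x = poly (antidiagonal_poly H) x"
  unfolding hform_def antidiagonal_poly_def sum_lessThan_5 by (simp add: algebra_simps eval_nat_numeral)

lemma hmat_parametrizes_symmetric:
  assumes sym: "\<And>i j. H i j = H j i" and diag: "\<And>x. hform H x x = fC a x"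
  obtains p where "wp_symmetric p" "\<And>i j. i < 5 \<Longrightarrow> j < 5 \<Longrightarrow> hmat a p i j = H i j"
proof
  define p where "p i j = [[(6 * a 2 - H 0 2) / 2, (4 * a 3 - H 0 3) / 2, (a 4 - H 0 4) / 2],
      [(4 * a 3 - H 0 3) / 2, (16 * a 4 + 2 * (a 4 - H 0 4) - H 1 3) / 2, (4 * a 5 - H 1 4) / 2],
      [(a 4 - H 0 4) / 2, (4 * a 5 - H 1 4) / 2, (6 * a 6 - H 2 4) / 2]] ! (i - 1) ! (j - 1)" for i j
  show "wp_symmetric p" by (simp add: wp_symmetric_def p_def)
  have "poly (antidiagonal_poly H) =
      poly [:a 0, 8 * a 1, 28 * a 2, 56 * a 3, 70 * a 4, 56 * a 5, 28 * a 6, 8 * a 7, a 8:]"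
    using diag unfolding fC_eq_poly hform_diagonal by blast
  then have antidiagonals: "a 0 = H 0 0" "8 * a 1 = 2 * H 0 1" "28 * a 2 = 2 * H 0 2 + H 1 1"
    "56 * a 3 = 2 * H 0 3 + 2 * H 1 2" "70 * a 4 = 2 * H 0 4 + (2 * H 1 3 + H 2 2)"
    "56 * a 5 = 2 * H 1 4 + 2 * H 2 3" "28 * a 6 = 2 * H 2 4 + H 3 3" "8 * a 7 = 2 * H 3 4" "a 8 = H 4 4"
    unfolding poly_eq_poly_eq_iff antidiagonal_poly_def sym [of 1 0] sym [of 2 0] sym [of 3 0] sym [of 4 0] sym [of 2 1]
      sym [of 3 1] sym [of 4 1] sym [of 3 2] sym [of 4 2] sym [of 4 3]
    by simp_all
  have off_border: "H 1 1 = 28 * a 2 - 2 * H 0 2" "H 1 2 = 28 * a 3 - H 0 3"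
    "H 2 2 = 70 * a 4 - 2 * H 0 4 - 2 * H 1 3" "H 2 3 = 28 * a 5 - H 1 4" "H 3 3 = 28 * a 6 - 2 * H 2 4"
    and border: "4 * a 1 = H 0 1" "4 * a 7 = H 3 4"
    using antidiagonals(2-8) by algebra+
  have entries: "6 * a 2 - 2 * p 1 1 = H 0 2" "4 * a 3 - 2 * p 1 2 = H 0 3" "a 4 - 2 * p 1 3 = H 0 4"
    "16 * a 2 + 4 * p 1 1 = H 1 1" "24 * a 3 + 2 * p 1 2 = H 1 2" "16 * a 4 - 2 * p 2 2 + 4 * p 1 3 = H 1 3"
    "4 * a 5 - 2 * p 2 3 = H 1 4" "36 * a 4 + 4 * p 2 2 - 4 * p 1 3 = H 2 2" "24 * a 5 + 2 * p 2 3 = H 2 3"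
    "6 * a 6 - 2 * p 3 3 = H 2 4" "16 * a 6 + 4 * p 3 3 = H 3 3"
    unfolding off_border by (simp_all add: p_def field_simps)
  show "hmat a p i j = H i j" if "i < 5" "j < 5" for i j
    using that [THEN less_5_cases] unfolding hmat_def antidiagonals(1,9) entries border
    by (elim disjE; simp; simp add: sym)
qed

lemma hmat_cong: "(\<And>i j. i \<in> {1,2,3} \<Longrightarrow> j \<in> {1,2,3} \<Longrightarrow> p i j = p' i j) \<Longrightarrow> hmat a p = hmat a p'"
  by (intro ext) (simp add: hmat_def)

lemma hmat_eq_rank3_matrix:
  assumes p: "wp_symmetric p" and f: "\<And>x. fC a x = (poly L x)\<^sup>2 + poly K x * poly W x"
    and deg: "degree L < 5" "degree K < 5" "degree W < 5"
    and Z: "card Z = 4" "\<And>z. z \<in> Z \<Longrightarrow> poly W z = 0"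
    and h: "\<And>z w. z \<in> Z \<Longrightarrow> w \<in> Z \<Longrightarrow> z \<noteq> w \<Longrightarrow> hform (hmat a p) z w = poly L z * poly L w"
    and ij: "i < 5" "j < 5"
  shows "hmat a p i j = rank3_matrix L K W i j"
proof -
  have "rank3_matrix L K W i j = rank3_matrix L K W j i" for i j
    by (simp add: rank3_matrix_def algebra_simps)
  moreover have "hform (rank3_matrix L K W) x x = fC a x" for x
    by (simp add: hform_rank3_matrix [OF deg] f power2_eq_square)
  ultimately obtain p' where p': "wp_symmetric p'"
    and hp': "\<And>i j. i < 5 \<Longrightarrow> j < 5 \<Longrightarrow> hmat a p' i j = rank3_matrix L K W i j"
    using hmat_parametrizes_symmetric by blast
  have hform_p': "hform (hmat a p') x y = hform (rank3_matrix L K W) x y" for x y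
    unfolding hform_def using hp' by (intro sum.cong) auto
  have "wp_form (\<lambda>i j. p i j - p' i j) z w = 0" if "z \<in> Z" "w \<in> Z" "z \<noteq> w" for z w
    using hform_hmat_diff [OF p p', of a z w] h [OF that] Z(2) that
    by (simp add: hform_p' hform_rank3_matrix [OF deg] wp_form_diff)
  from wp_form_eq_0_imp_eq_0 [OF Z(1) this] have "hmat a p = hmat a p'"
    by (intro hmat_cong) (metis eq_iff_diff_eq_0)
  then show ?thesis using hp' [OF ij] by simp
qed

definition det3 ::
  "complex \<times> complex \<times> complex \<Rightarrow> complex \<times> complex \<times> complex \<Rightarrow> complex \<times> complex \<times> complex \<Rightarrow> complex" where
  "det3 u v w = (case (u, v, w) of ((a, b, c), (a', b', c'), (a'', b'', c'')) \<Rightarrow>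
     a * (b' * c'' - c' * b'') - b * (a' * c'' - c' * a'') + c * (a' * b'' - b' * a''))"

lemma sum_increasing_triples_5:
  fixes g :: "nat \<Rightarrow> nat \<Rightarrow> nat \<Rightarrow> complex"
  shows "(\<Sum>k<5. \<Sum>j<k. \<Sum>i<j. g i j k) = g 0 1 2 + g 0 1 3 + g 0 1 4 + g 0 2 3 + g 0 2 4 + g 0 3 4
    + g 1 2 3 + g 1 2 4 + g 1 3 4 + g 2 3 4"
  by (simp add: eval_nat_numeral)

lemma det3_cauchy_binet:
  fixes l k m u v w :: "nat \<Rightarrow> complex"
  shows "det3 (\<Sum>i<5. l i * u i, \<Sum>i<5. k i * u i, \<Sum>i<5. m i * u i)
      (\<Sum>i<5. l i * v i, \<Sum>i<5. k i * v i, \<Sum>i<5. m i * v i)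
      (\<Sum>i<5. l i * w i, \<Sum>i<5. k i * w i, \<Sum>i<5. m i * w i) =
    (\<Sum>r<5. \<Sum>j<r. \<Sum>i<j. det3 (l i, k i, m i) (l j, k j, m j) (l r, k r, m r)
      * det3 (u i, u j, u r) (v i, v j, v r) (w i, w j, w r))"
  unfolding sum_increasing_triples_5 det3_def sum_lessThan_5 prod.case by algebra

definition minor :: "complex poly \<Rightarrow> complex poly \<Rightarrow> complex poly \<Rightarrow> nat \<Rightarrow> nat \<Rightarrow> nat \<Rightarrow> complex" where
  "minor L K W i j k =
    det3 (coeff L i, coeff K i, coeff W i) (coeff L j, coeff K j, coeff W j) (coeff L k, coeff K k, coeff W k)"

text \<open>The Schur functions, quotients of monomial determinants by the Vandermonde determinant, in three
  variables: if \<open>n i j k\<close> is the coefficient of the determinant of \<open>x\<^sup>i, x\<^sup>j, x\<^sup>k\<close>, then \<open>schur_tensor n\<close> collects the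
  coefficients of the quotient.\<close>
definition schur_tensor :: "(nat \<Rightarrow> nat \<Rightarrow> nat \<Rightarrow> complex) \<Rightarrow> nat \<Rightarrow> nat \<Rightarrow> nat \<Rightarrow> complex" where
  "schur_tensor n i j k =
    [[[n 0 1 2, n 0 1 3, n 0 1 4],
      [n 0 1 3, n 0 1 4 + n 0 2 3, n 0 2 4],
      [n 0 1 4, n 0 2 4, n 0 3 4]],
     [[n 0 1 3, n 0 1 4 + n 0 2 3, n 0 2 4],
      [n 0 1 4 + n 0 2 3, 2 * n 0 2 4 + n 1 2 3, n 0 3 4 + n 1 2 4],
      [n 0 2 4, n 0 3 4 + n 1 2 4, n 1 3 4]],
     [[n 0 1 4, n 0 2 4, n 0 3 4],
      [n 0 2 4, n 0 3 4 + n 1 2 4, n 1 3 4],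
      [n 0 3 4, n 1 3 4, n 2 3 4]]] ! (i - 1) ! (j - 1) ! (k - 1)"

definition contract :: "(nat \<Rightarrow> nat \<Rightarrow> nat \<Rightarrow> complex) \<Rightarrow> complex \<Rightarrow> nat \<Rightarrow> nat \<Rightarrow> complex" where
  "contract q x i j = (\<Sum>k<3. q i j (Suc k) * x ^ k)"

lemma wp_form_contract_schur_tensor:
  "wp_form (contract (schur_tensor n) z) x y =
     n 0 1 2 + n 0 1 3 * (x + y + z) + n 0 1 4 * (x\<^sup>2 + y\<^sup>2 + z\<^sup>2 + x * y + x * z + y * z)
     + n 0 2 3 * (x * y + x * z + y * z) + n 0 2 4 * (x + y) * (x + z) * (y + z)
     + n 0 3 4 * (x\<^sup>2 * y\<^sup>2 + x\<^sup>2 * z\<^sup>2 + y\<^sup>2 * z\<^sup>2 + x * y * z * (x + y + z)) + n 1 2 3 * (x * y * z)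
     + n 1 2 4 * (x * y * z * (x + y + z)) + n 1 3 4 * (x * y * z * (x * y + x * z + y * z))
     + n 2 3 4 * (x * y * z)\<^sup>2"
  unfolding wp_form_def contract_def sum_lessThan_3 schur_tensor_def
  by (simp add: numeral_2_eq_2 [symmetric] numeral_3_eq_3 [symmetric]) algebra

lemma vandermonde_mult_schur_tensor:
  "(y - x) * (z - x) * (z - y) * wp_form (contract (schur_tensor n) z) x y =
    (\<Sum>k<5. \<Sum>j<k. \<Sum>i<j. n i j k * det3 (x ^ i, x ^ j, x ^ k) (y ^ i, y ^ j, y ^ k) (z ^ i, z ^ j, z ^ k))"
  unfolding wp_form_contract_schur_tensor sum_increasing_triples_5 det3_def prod.case by simp algebra

lemma confluent_vandermonde_mult_schur_tensor:
  "(z - x)\<^sup>2 * wp_form (contract (schur_tensor n) z) x z =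
    (\<Sum>k<5. \<Sum>j<k. \<Sum>i<j. n i j k * det3 (x ^ i, x ^ j, x ^ k) (z ^ i, z ^ j, z ^ k)
      (of_nat i * z ^ (i - 1), of_nat j * z ^ (j - 1), of_nat k * z ^ (k - 1)))"
  unfolding wp_form_contract_schur_tensor sum_increasing_triples_5 det3_def prod.case by simp algebra

definition values3 :: "complex poly \<Rightarrow> complex poly \<Rightarrow> complex poly \<Rightarrow> complex \<Rightarrow> complex \<times> complex \<times> complex" where
  "values3 L K W x = (poly L x, poly K x, poly W x)"

lemma poly_pderiv_eq_sum_lessThan:
  fixes p :: "complex poly"
  assumes "degree p < n"
  shows "poly (pderiv p) x = (\<Sum>i<n. coeff p i * (of_nat i * x ^ (i - 1)))"
proof -
  have "((\<lambda>x. \<Sum>i<n. coeff p i * x ^ i) has_field_derivative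
      (\<Sum>i<n. coeff p i * (of_nat i * x ^ (i - 1)))) (at x)"
    by (auto intro!: derivative_eq_intros simp: mult_ac)
  moreover have "poly p = (\<lambda>x. \<Sum>i<n. coeff p i * x ^ i)"
    using poly_eq_sum_lessThan [OF assms] by auto
  ultimately show ?thesis using poly_DERIV [of p x] DERIV_unique by simp
qed

lemma schur_tensor_minor:
  assumes deg: "degree L < 5" "degree K < 5" "degree W < 5"
  shows "(y - x) * (z - x) * (z - y) * wp_form (contract (schur_tensor (minor L K W)) z) x y =
      det3 (values3 L K W x) (values3 L K W y) (values3 L K W z)"
    and "(z - x)\<^sup>2 * wp_form (contract (schur_tensor (minor L K W)) z) x z =
      det3 (values3 L K W x) (values3 L K W z) (values3 (pderiv L) (pderiv K) (pderiv W) z)"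
  unfolding vandermonde_mult_schur_tensor confluent_vandermonde_mult_schur_tensor minor_def values3_def
    deg [THEN poly_eq_sum_lessThan] deg [THEN poly_pderiv_eq_sum_lessThan] det3_cauchy_binet
  by (rule refl)+

lemma minor_laplace_expansion:
  assumes "c \<in> {L, K, W}"
  defines "n \<equiv> minor L K W"
  shows "coeff c i * n j k l - coeff c j * n i k l + coeff c k * n i j l - coeff c l * n i j k = 0"
proof -
  have "coeff L i * n j k l - coeff L j * n i k l + coeff L k * n i j l - coeff L l * n i j k = 0"
    "coeff K i * n j k l - coeff K j * n i k l + coeff K k * n i j l - coeff K l * n i j k = 0"
    "coeff W i * n j k l - coeff W j * n i k l + coeff W k * n i j l - coeff W l * n i j k = 0"
    unfolding n_def minor_def det3_def prod.case by algebra+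
  then show ?thesis using assms(1) by blast
qed

lemma sum_mult_Amat_schur_tensor:
  assumes "k < 5"
  shows "(\<Sum>j<5. c j * Amat (schur_tensor n) j k) =
    [c 1 * n 2 3 4 - c 2 * n 1 3 4 + c 3 * n 1 2 4 - c 4 * n 1 2 3,
     - (c 0 * n 2 3 4 - c 2 * n 0 3 4 + c 3 * n 0 2 4 - c 4 * n 0 2 3),
     c 0 * n 1 3 4 - c 1 * n 0 3 4 + c 3 * n 0 1 4 - c 4 * n 0 1 3,
     - (c 0 * n 1 2 4 - c 1 * n 0 2 4 + c 2 * n 0 1 4 - c 4 * n 0 1 2),
     c 0 * n 1 2 3 - c 1 * n 0 2 3 + c 2 * n 0 1 3 - c 3 * n 0 1 2] ! k"
  using less_5_cases [OF assms]
  by (elim disjE) (simp_all add: sum_lessThan_5 Amat_def schur_tensor_def algebra_simps)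

lemma coeff_Amat_schur_tensor:
  assumes "c \<in> {L, K, W}" "k < 5"
  shows "(\<Sum>j<5. coeff c j * Amat (schur_tensor (minor L K W)) j k) = 0"
  unfolding sum_mult_Amat_schur_tensor [OF assms(2)] minor_laplace_expansion [OF assms(1)]
  using less_5_cases [OF assms(2)] by auto

lemma rank3_matrix_Amat_schur_tensor:
  assumes "k < 5"
  shows "(\<Sum>j<5. rank3_matrix L K W i j * Amat (schur_tensor (minor L K W)) j k) = 0"
proof -
  let ?A = "Amat (schur_tensor (minor L K W))"
  have "(\<Sum>j<5. rank3_matrix L K W i j * ?A j k) = coeff L i * (\<Sum>j<5. coeff L j * ?A j k)
      + (coeff K i * (\<Sum>j<5. coeff W j * ?A j k) + coeff W i * (\<Sum>j<5. coeff K j * ?A j k)) / 2"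
    unfolding rank3_matrix_def sum_lessThan_5 by (simp add: algebra_simps add_divide_distrib)
  then show ?thesis using coeff_Amat_schur_tensor [OF _ assms, of _ L K W] by simp
qed

lemma Amat_cong:
  "(\<And>i j k. i \<in> {1,2,3} \<Longrightarrow> j \<in> {1,2,3} \<Longrightarrow> k \<in> {1,2,3} \<Longrightarrow> q i j k = q' i j k) \<Longrightarrow> Amat q = Amat q'"
  by (intro ext) (simp add: Amat_def)

lemma Amat_mult:
  assumes "i < 5" "j < 5"
  shows "Amat (\<lambda>i j k. c * q i j k) i j = c * Amat q i j"
  using assms [THEN less_5_cases] by (elim disjE) (simp_all add: Amat_def algebra_simps)

lemma wp_symmetric_contract:
  assumes "\<And>k. wp_symmetric (\<lambda>i j. q i j k)"
  shows "wp_symmetric (contract q x)"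
  unfolding wp_symmetric_def contract_def
proof (intro ballI sum.cong refl)
  show "q i j (Suc k) * x ^ k = q j i (Suc k) * x ^ k" if "i \<in> {1,2,3}" "j \<in> {1,2,3}" for i j k
    using wp_symmetricD [OF assms that, of "Suc k"] by simp
qed

lemma wp_tensor_eqI:
  assumes Z: "card Z = 4"
    and form_eq: "\<And>x z w. x \<in> Z \<Longrightarrow> z \<in> Z \<Longrightarrow> w \<in> Z \<Longrightarrow> z \<noteq> w \<Longrightarrow>
      wp_form (contract q x) z w = wp_form (contract T x) z w"
    and ijk: "i \<in> {1,2,3}" "j \<in> {1,2,3}" "k \<in> {1,2,3}"
  shows "q i j k = T i j k"
proof -
  have contract_eq: "contract q x i j - contract T x i j = 0" if "x \<in> Z" for x
  proof (rule wp_form_eq_0_imp_eq_0 [OF Z _ ijk(1,2)])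
    show "wp_form (\<lambda>i j. contract q x i j - contract T x i j) z w = 0" if "z \<in> Z" "w \<in> Z" "z \<noteq> w" for z w
      using form_eq [OF \<open>x \<in> Z\<close> that] by (simp add: wp_form_diff)
  qed
  have "q i j (Suc (k - 1)) - T i j (Suc (k - 1)) = 0"
  proof (rule power_sum_eq_0_imp_coeff_eq_0 [where S = Z and n = 3 and c = "\<lambda>k. q i j (Suc k) - T i j (Suc k)"])
    show "(\<Sum>k<3. (q i j (Suc k) - T i j (Suc k)) * x ^ k) = 0" if "x \<in> Z" for x
      using contract_eq [OF that] by (simp add: contract_def sum_subtractf left_diff_distrib)
  qed (use Z ijk(3) in auto)
  moreover have "Suc (k - 1) = k" using ijk(3) by auto
  ultimately show ?thesis by simp
qed

lemma eq_schur_tensorI: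
  assumes deg: "degree L < 5" "degree K < 5" "degree W < 5"
    and Z: "card Z = 4" "\<And>z. z \<in> Z \<Longrightarrow> poly W z = 0"
    and q: "\<And>k. wp_symmetric (\<lambda>i j. q i j k)"
    and fixed: "\<And>x z w. x \<in> Z \<Longrightarrow> z \<in> Z - {x} \<Longrightarrow> w \<in> Z - {x} \<Longrightarrow> z \<noteq> w \<Longrightarrow> wp_form (contract q x) z w = 0"
    and moving: "\<And>x z. x \<in> Z \<Longrightarrow> z \<in> Z - {x} \<Longrightarrow>
       4 * (z - x)\<^sup>2 * wp_form (contract q x) z x = poly (pderiv W) x * (poly K z * poly L x - poly L z * poly K x)"
    and ijk: "i \<in> {1,2,3}" "j \<in> {1,2,3}" "k \<in> {1,2,3}"
  shows "q i j k = - (1 / 4) * schur_tensor (minor L K W) i j k"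
proof (rule wp_tensor_eqI [OF Z(1) _ ijk])
  define T where "T i j k = - (1 / 4) * schur_tensor (minor L K W) i j k" for i j k
  have T: "wp_form (contract T x) z w = - (1 / 4) * wp_form (contract (schur_tensor (minor L K W)) x) z w" for x z w
    by (simp add: T_def contract_def wp_form_def sum_negf flip: sum_divide_distrib)
  have moving_eq: "wp_form (contract q x) z x = wp_form (contract T x) z x" if "x \<in> Z" "z \<in> Z - {x}" for x z
  proof -
    have "4 * (z - x)\<^sup>2 * wp_form (contract T x) z x = - ((x - z)\<^sup>2 * wp_form (contract (schur_tensor (minor L K W)) x) z x)"
      by (simp add: T power2_commute)
    also have "\<dots> = poly (pderiv W) x * (poly K z * poly L x - poly L z * poly K x)"
      using Z(2) that by (simp add: schur_tensor_minor(2) [OF deg] det3_def values3_def algebra_simps)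
    also have "\<dots> = 4 * (z - x)\<^sup>2 * wp_form (contract q x) z x"
      using moving [OF that] by simp
    finally show ?thesis using that by simp
  qed
  have sym: "wp_symmetric (contract q x)" "wp_symmetric (contract T x)" for x
    using q by (auto intro!: wp_symmetric_contract) (simp add: T_def wp_symmetric_def schur_tensor_def)
  show "wp_form (contract q x) z w = wp_form (contract (\<lambda>i j k. - (1 / 4) * schur_tensor (minor L K W) i j k) x) z w"
    if x: "x \<in> Z" and zw: "z \<in> Z" "w \<in> Z" "z \<noteq> w" for x z w
    unfolding T_def [symmetric]
  proof -
    consider (right) "w = x" | (left) "z = x" | (neither) "z \<noteq> x" "w \<noteq> x" by blast
    then show "wp_form (contract q x) z w = wp_form (contract T x) z w"
    proof cases
      case right
      then show ?thesis using moving_eq x zw by simp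
    next
      case left
      then show ?thesis
        using moving_eq [of x w] x zw wp_form_commute [OF sym(1), of x x w] wp_form_commute [OF sym(2), of x x w]
        by simp
    next
      case neither
      have "(w - z) * (x - z) * (x - w) * wp_form (contract (schur_tensor (minor L K W)) x) z w = 0"
        using Z(2) x zw by (simp add: schur_tensor_minor(1) [OF deg] det3_def values3_def)
      then have "wp_form (contract T x) z w = 0"
        using neither zw(3) by (simp add: T)
      then show ?thesis using fixed [of x z w] neither x zw by auto
    qed
  qed
qed

lemma hmat_Amat_eq_0:
  assumes hmat: "\<And>i j. i < 5 \<Longrightarrow> j < 5 \<Longrightarrow> hmat a p i j = rank3_matrix L K W i j"
    and q: "\<And>i j k. i \<in> {1,2,3} \<Longrightarrow> j \<in> {1,2,3} \<Longrightarrow> k \<in> {1,2,3} \<Longrightarrow>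
      q i j k = r * schur_tensor (minor L K W) i j k"
    and "i < 5" "k < 5"
  shows "(\<Sum>j<5. hmat a p i j * Amat q j k) = 0"
proof -
  let ?T = "schur_tensor (minor L K W)"
  have "Amat q = Amat (\<lambda>i j k. r * ?T i j k)"
    using q by (intro Amat_cong) simp
  then have "(\<Sum>j<5. hmat a p i j * Amat q j k) = r * (\<Sum>j<5. rank3_matrix L K W i j * Amat ?T j k)"
    using hmat [OF \<open>i < 5\<close>] Amat_mult [OF _ \<open>k < 5\<close>]
    by (simp add: sum_distrib_left mult_ac)
  then show ?thesis using rank3_matrix_Amat_schur_tensor [OF \<open>k < 5\<close>] by simp
qed

lemma continuous_on_hmat:
  assumes "\<And>i j. i \<in> {1,2,3} \<Longrightarrow> j \<in> {1,2,3} \<Longrightarrow> continuous_on D (p i j)" "i < 5" "j < 5"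
  shows "continuous_on D (\<lambda>u. hmat a (\<lambda>i j. p i j u) i j)"
proof -
  have entries: "continuous_on D (\<lambda>u. p i j u)" if "i \<in> {1,2,3}" "j \<in> {1,2,3}" for i j
    using assms(1) [OF that] by simp
  show ?thesis
    using assms(2,3) [THEN less_5_cases]
    by (elim disjE; simp add: hmat_def;
        intro continuous_on_add continuous_on_diff continuous_on_mult continuous_on_const entries; simp)
qed

lemma continuous_on_Amat:
  assumes "\<And>i j k. i \<in> {1,2,3} \<Longrightarrow> j \<in> {1,2,3} \<Longrightarrow> k \<in> {1,2,3} \<Longrightarrow> continuous_on D (q i j k)"
    "i < 5" "j < 5"
  shows "continuous_on D (\<lambda>u. Amat (\<lambda>i j k. q i j k u) i j)"
proof -
  have entries: "continuous_on D (\<lambda>u. q i j k u)" if "i \<in> {1,2,3}" "j \<in> {1,2,3}" "k \<in> {1,2,3}" for i j k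
    using assms(1) [OF that] by simp
  show ?thesis
    using assms(2,3) [THEN less_5_cases]
    by (elim disjE; simp add: Amat_def;
        intro continuous_on_add continuous_on_diff continuous_on_minus continuous_on_mult continuous_on_const entries; simp)
qed

section \<open>Holomorphic functions of three variables\<close>

lemma upd3_add: "upd3 k (s + t) u = upd3 k t (upd3 k s u)"
  by (simp add: upd3_def add3_def algebra_simps)

lemma upd3_diff: "upd3 k t u - upd3 k t v = u - v"
  by (cases u, cases v) (simp add: upd3_def add3_def)

lemma dist_upd3 [simp]: "dist (upd3 k t u) u = norm t"
  by (cases u) (simp add: upd3_def add3_def dist_norm norm_Pair)

lemma holo3_has_field_derivative:
  assumes "holo3 F D" "k \<in> {1,2,3}" "upd3 k s u \<in> D"
  shows "((\<lambda>t. F (upd3 k t u)) has_field_derivative pderiv3 F k (upd3 k s u)) (at s)"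
proof -
  have "((\<lambda>t. F (upd3 k t (upd3 k s u))) has_field_derivative pderiv3 F k (upd3 k s u)) (at 0)"
    using assms unfolding holo3_def pderiv3_def DERIV_deriv_iff_field_differentiable by blast
  then have "((\<lambda>t. F (upd3 k (s + t) u)) has_field_derivative pderiv3 F k (upd3 k s u)) (at 0)"
    by (simp add: upd3_add)
  then show ?thesis
    using DERIV_shift [of "\<lambda>t. F (upd3 k t u)" _ 0 s] by (simp add: add.commute)
qed

lemma holo3_partial_has_derivative:
  assumes "holo3 F D" "(x, y, z) \<in> D"
  shows "((\<lambda>x. F (x, y, z)) has_derivative (*) (pderiv3 F 1 (x, y, z))) (at x)"
    and "((\<lambda>y. F (x, y, z)) has_derivative (*) (pderiv3 F 2 (x, y, z))) (at y)"
    and "((\<lambda>z. F (x, y, z)) has_derivative (*) (pderiv3 F 3 (x, y, z))) (at z)"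
  using holo3_has_field_derivative [OF assms(1), of 1 x "(0, y, z)"]
    holo3_has_field_derivative [OF assms(1), of 2 y "(x, 0, z)"]
    holo3_has_field_derivative [OF assms(1), of 3 z "(x, y, 0)"] assms(2)
  by (simp_all add: upd3_def add3_def has_field_derivative_def)

lemma uniform_limit_upd3:
  assumes F: "continuous_on D F" and D: "open D" "u0 \<in> D"
  obtains r where "r > 0" "uniform_limit (ball 0 r) (\<lambda>u t. F (upd3 k t u)) (\<lambda>t. F (upd3 k t u0)) (nhds u0)"
    "\<And>u t. u \<in> ball u0 r \<Longrightarrow> t \<in> ball 0 r \<Longrightarrow> upd3 k t u \<in> D"
proof -
  obtain R where R: "R > 0" "cball u0 R \<subseteq> D"
    using D open_contains_cball by blast
  define r where "r = R / 2"
  have r: "r > 0" using R by (simp add: r_def)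
  have in_cball: "upd3 k t u \<in> cball u0 R" if "u \<in> ball u0 r" "t \<in> ball 0 r" for u t
    using dist_triangle [of "upd3 k t u" u0 u] that by (simp add: r_def dist_commute [of u0])
  have unif: "uniformly_continuous_on (cball u0 R) F"
    using F R(2) by (meson compact_cball compact_uniformly_continuous continuous_on_subset)
  have "uniform_limit (ball 0 r) (\<lambda>u t. F (upd3 k t u)) (\<lambda>t. F (upd3 k t u0)) (nhds u0)"
  proof (rule uniform_limitI)
    fix e :: real assume "e > 0"
    then obtain d where d: "d > 0"
      "\<And>v w. v \<in> cball u0 R \<Longrightarrow> w \<in> cball u0 R \<Longrightarrow> dist v w < d \<Longrightarrow> dist (F v) (F w) < e"
      using unif unfolding uniformly_continuous_on_def by metis
    have "dist (F (upd3 k t u)) (F (upd3 k t u0)) < e" if "u \<in> ball u0 (min d r)" "t \<in> ball 0 r" for u t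
    proof (rule d(2))
      show "dist (upd3 k t u) (upd3 k t u0) < d"
        using that(1) by (simp add: dist_norm upd3_diff norm_minus_commute)
    qed (use in_cball that r in auto)
    moreover have "\<forall>\<^sub>F u in nhds u0. u \<in> ball u0 (min d r)"
      using d(1) r by (intro eventually_nhds_in_open) auto
    ultimately show "\<forall>\<^sub>F u in nhds u0. \<forall>t\<in>ball 0 r. dist (F (upd3 k t u)) (F (upd3 k t u0)) < e"
      by (auto elim: eventually_mono)
  qed
  then show thesis
    by (rule that [OF r]) (use in_cball R(2) in blast)
qed

lemma continuous_on_pderiv3:
  assumes F: "holo3 F D" and D: "open D" and k: "k \<in> {1,2,3}"
  shows "continuous_on D (pderiv3 F k)"
  unfolding continuous_on_def
proof
  fix u0 assume "u0 \<in> D"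
  moreover have "continuous_on D F" using F by (simp add: holo3_def)
  ultimately obtain r where r: "r > 0"
    and lim: "uniform_limit (ball 0 r) (\<lambda>u t. F (upd3 k t u)) (\<lambda>t. F (upd3 k t u0)) (nhds u0)"
    and in_D: "\<And>u t. u \<in> ball u0 r \<Longrightarrow> t \<in> ball 0 r \<Longrightarrow> upd3 k t u \<in> D"
    using D uniform_limit_upd3 [of D F u0 k] by blast
  have "(\<lambda>t. F (upd3 k t u)) holomorphic_on ball 0 r" if "u \<in> ball u0 r" for u
    using holo3_has_field_derivative [OF F k in_D [OF that]]
    unfolding holomorphic_on_open [OF open_ball] by blast
  moreover have "\<forall>\<^sub>F u in nhds u0. u \<in> ball u0 r"
    using r by (intro eventually_nhds_in_open) auto
  ultimately have "\<forall>\<^sub>F u in nhds u0. (\<lambda>t. F (upd3 k t u)) holomorphic_on ball 0 r"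
    by (auto elim: eventually_mono)
  then have "((\<lambda>u. deriv (\<lambda>t. F (upd3 k t u)) 0) \<longlongrightarrow> deriv (\<lambda>t. F (upd3 k t u0)) 0) (nhds u0)"
    using r by (intro deriv_complex_uniform_limit [OF lim]) auto
  then show "(pderiv3 F k \<longlongrightarrow> pderiv3 F k u0) (at u0 within D)"
    unfolding pderiv3_def [abs_def] by (rule tendsto_mono [OF at_within_le_nhds])
qed

lemma open_contains_box3:
  fixes D :: "('a::metric_space \<times> 'b::metric_space \<times> 'c::metric_space) set"
  assumes "open D" "(x, y, z) \<in> D"
  obtains r where "r > 0" "ball x r \<times> ball y r \<times> ball z r \<subseteq> D"
proof -
  obtain A B where A: "open A" "x \<in> A" and B: "open B" "(y, z) \<in> B" and AB: "A \<times> B \<subseteq> D"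
    using assms by (rule open_prod_elim) auto
  obtain B1 B2 where B1: "open B1" "y \<in> B1" and B2: "open B2" "z \<in> B2" and B12: "B1 \<times> B2 \<subseteq> B"
    using B by (rule open_prod_elim) auto
  obtain r1 r2 r3 where "r1 > 0" "ball x r1 \<subseteq> A" "r2 > 0" "ball y r2 \<subseteq> B1" "r3 > 0" "ball z r3 \<subseteq> B2"
    using A B1 B2 open_contains_ball by metis
  then show thesis
    using AB B12 by (intro that [of "min r1 (min r2 r3)"]) fastforce+
qed

lemma holo3_slice_has_derivative:
  assumes F: "holo3 F D" and D: "open D" and in_D: "\<And>y z. y \<in> Y \<Longrightarrow> z \<in> Z \<Longrightarrow> (x, y, z) \<in> D"
    and "convex Z" and yz: "y \<in> Y" "z \<in> Z"
  shows "((\<lambda>(y, z). F (x, y, z)) has_derivative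
    (\<lambda>(q, r). pderiv3 F 2 (x, y, z) * q + pderiv3 F 3 (x, y, z) * r)) (at (y, z) within Y \<times> Z)"
proof -
  have "((\<lambda>(y, z). F (x, y, z)) has_derivative
      (\<lambda>(q, r). pderiv3 F 2 (x, y, z) * q + blinfun_mult_right (pderiv3 F 3 (x, y, z)) r)) (at (y, z) within Y \<times> Z)"
  proof (rule has_derivative_partialsI)
    show "((\<lambda>y. F (x, y, z)) has_derivative (*) (pderiv3 F 2 (x, y, z))) (at y within Y)"
      using holo3_partial_has_derivative(2) [OF F in_D] yz by (simp add: has_derivative_at_withinI)
    show "((\<lambda>z. F (x, y, z)) has_derivative blinfun_mult_right (pderiv3 F 3 (x, y, z))) (at z within Z)"
      if "y \<in> Y" "z \<in> Z" for y z
      using holo3_partial_has_derivative(3) [OF F in_D] that by (simp add: has_derivative_at_withinI)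
    have "continuous_on (Y \<times> Z) (\<lambda>yz. pderiv3 F 3 (x, yz))"
      using in_D by (intro continuous_on_compose2 [OF continuous_on_pderiv3 [OF F D, of 3]])
        (auto intro!: continuous_intros)
    then have "continuous_on (Y \<times> Z) (\<lambda>yz. blinfun_mult_right (pderiv3 F 3 (x, yz)))"
      by (rule bounded_linear.continuous_on [OF bounded_linear_blinfun_mult_right])
    then show "continuous (at (y, z) within Y \<times> Z) (\<lambda>(y, z). blinfun_mult_right (pderiv3 F 3 (x, y, z)))"
      using yz by (simp add: continuous_on_eq_continuous_within split_beta')
  qed (use yz \<open>convex Z\<close> in auto)
  then show ?thesis by simp
qed

lemma holo3_has_derivative:
  assumes F: "holo3 F D" and D: "open D" and u: "u \<in> D"
  shows "(F has_derivative (\<lambda>(p, q, r). pderiv3 F 1 u * p + (pderiv3 F 2 u * q + pderiv3 F 3 u * r))) (at u)"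
proof -
  obtain a b c where abc: "u = (a, b, c)" by (cases u)
  obtain \<rho> where "\<rho> > 0" and box: "ball a \<rho> \<times> ball b \<rho> \<times> ball c \<rho> \<subseteq> D"
    using open_contains_box3 [OF D u [unfolded abc]] by blast
  define X Y Z where "X = ball a \<rho>" and "Y = ball b \<rho>" and "Z = ball c \<rho>"
  have in_D: "X \<times> Y \<times> Z \<subseteq> D" and centre: "a \<in> X" "b \<in> Y" "c \<in> Z"
    and conv: "convex Z" "convex (Y \<times> Z)" and op: "open (X \<times> Y \<times> Z)"
    using \<open>\<rho> > 0\<close> box by (auto simp: X_def Y_def Z_def intro!: convex_Times open_Times)
  define dyz where "dyz x yz = (blinfun_mult_right (pderiv3 F 2 (x, yz)) o\<^sub>L fst_blinfun)
      + (blinfun_mult_right (pderiv3 F 3 (x, yz)) o\<^sub>L snd_blinfun)" for x and yz :: "complex \<times> complex"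
  have dyz_apply: "blinfun_apply (dyz x yz) = (\<lambda>(q, r). pderiv3 F 2 (x, yz) * q + pderiv3 F 3 (x, yz) * r)" for x yz
    by (auto simp: dyz_def blinfun.add_left fun_eq_iff)
  have "continuous_on (X \<times> Y \<times> Z) (pderiv3 F k)" if "k \<in> {1,2,3}" for k
    using continuous_on_pderiv3 [OF F D that] in_D by (rule continuous_on_subset)
  then have "continuous_on (X \<times> Y \<times> Z) (\<lambda>w. (blinfun_mult_right (pderiv3 F 2 w) o\<^sub>L fst_blinfun)
      + (blinfun_mult_right (pderiv3 F 3 w) o\<^sub>L snd_blinfun))"
    by (intro continuous_intros bounded_linear.continuous_on [OF bounded_linear_blinfun_mult_right]) auto
  then have "continuous (at (a, b, c) within X \<times> Y \<times> Z) (\<lambda>(x, yz). dyz x yz)"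
    using centre by (auto simp: continuous_on_eq_continuous_within dyz_def split_beta')
  moreover have "((\<lambda>x. F (x, b, c)) has_derivative (*) (pderiv3 F 1 u)) (at a within X)"
    using holo3_partial_has_derivative(1) [OF F] u by (simp add: abc has_derivative_at_withinI)
  moreover have "((\<lambda>yz. F (x, yz)) has_derivative dyz x yz) (at yz within Y \<times> Z)"
    if "x \<in> X" "yz \<in> Y \<times> Z" for x yz
  proof -
    have "(x, y, z) \<in> D" if "y \<in> Y" "z \<in> Z" for y z
      using in_D \<open>x \<in> X\<close> that by blast
    from holo3_slice_has_derivative [OF F D this conv(1), where Y = Y and y = "fst yz" and z = "snd yz"] show ?thesis
      using that(2) by (simp add: dyz_apply split_beta' mem_Times_iff)
  qed
  ultimately have "((\<lambda>(x, yz). F (x, yz)) has_derivative (\<lambda>(p, qr). pderiv3 F 1 u * p + dyz a (b, c) qr))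
      (at (a, b, c) within X \<times> Y \<times> Z)"
    using centre conv(2) by (intro has_derivative_partialsI [where Y = "Y \<times> Z"]) auto
  moreover have "at (a, b, c) within X \<times> Y \<times> Z = at u"
    unfolding abc by (rule at_within_open [OF _ op]) (use centre in simp)
  ultimately show ?thesis
    by (simp add: abc dyz_apply split_beta')
qed

section \<open>Differentiating the defining relations\<close>

lemma wp_form_increment_has_field_derivative:
  assumes p: "\<And>i j. i \<in> {1,2,3} \<Longrightarrow> j \<in> {1,2,3} \<Longrightarrow> ((\<lambda>t. p t i j) has_field_derivative p' i j) (at x)"
    and m: "(m has_field_derivative m') (at x)"
  shows "((\<lambda>t. wp_form (\<lambda>i j. p t i j - p x i j) z (m t)) has_field_derivative wp_form p' z (m x)) (at x)"
  unfolding wp_form_def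
proof (intro DERIV_sum)
  fix i j :: nat assume "i \<in> {..<3}" "j \<in> {..<3}"
  then have "Suc i \<in> {1,2,3}" "Suc j \<in> {1,2,3}" by auto
  from DERIV_diff [OF p [OF this] DERIV_const]
  have "((\<lambda>t. p t (Suc i) (Suc j) - p x (Suc i) (Suc j)) has_field_derivative p' (Suc i) (Suc j)) (at x)"
    by simp
  from DERIV_mult [OF DERIV_cmult_right [OF this, of "z ^ i"] DERIV_power [OF m, of j]]
  show "((\<lambda>t. (p t (Suc i) (Suc j) - p x (Suc i) (Suc j)) * z ^ i * m t ^ j) has_field_derivative
      p' (Suc i) (Suc j) * z ^ i * m x ^ j) (at x)"
    by simp
qed

lemma hform_increment_has_field_derivative:
  assumes p: "\<And>i j. i \<in> {1,2,3} \<Longrightarrow> j \<in> {1,2,3} \<Longrightarrow> ((\<lambda>t. p t i j) has_field_derivative p' i j) (at x)"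
    and sym: "\<And>t. wp_symmetric (p t)" and m: "(m has_field_derivative m') (at x)"
  shows "((\<lambda>t. hform (hmat a (p t)) z (m t) - hform (hmat a (p x)) z (m t)) has_field_derivative
    - 2 * (z - m x)\<^sup>2 * wp_form p' z (m x)) (at x)"
proof -
  have "((\<lambda>t. - 2 * (z - m t)\<^sup>2) has_field_derivative - 2 * (2 * (z - m x) * (- m'))) (at x)"
    using m by (auto intro!: derivative_eq_intros)
  note DERIV_mult [OF this wp_form_increment_has_field_derivative [where p = p and p' = p' and z = z, OF p m]]
  moreover have "wp_form (\<lambda>i j. 0) z w = 0" for w
    by (simp add: wp_form_def)
  ultimately show ?thesis
    by (simp add: hform_hmat_diff [OF sym sym] wp_form_diff mult.commute)
qed

lemma abel_branch_ordinate_has_field_derivative: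
  assumes br: "abel_branch a U Y \<Phi>" and x: "x \<in> U"
  shows "(Y has_field_derivative fC' a x / (2 * Y x)) (at x)"
proof -
  have Y: "(Y has_field_derivative deriv Y x) (at x)"
    by (rule holomorphic_derivI [OF abel_branchD(3,1) [OF br] x])
  then have "((\<lambda>t. (Y t)\<^sup>2) has_field_derivative 2 * Y x * deriv Y x) (at x)"
    by (auto intro!: derivative_eq_intros)
  moreover have "((\<lambda>t. (Y t)\<^sup>2) has_field_derivative fC' a x) (at x)"
  proof (rule has_field_derivative_transform_within_open [OF _ abel_branchD(1) [OF br] x])
    show "(poly (fpoly a) has_field_derivative fC' a x) (at x)"
      using poly_DERIV [of "fpoly a" x] by (simp add: poly_pderiv_fpoly)
  qed (simp add: poly_fpoly abel_branchD(4) [OF br])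
  ultimately have "2 * Y x * deriv Y x = fC' a x" by (rule DERIV_unique)
  then have "deriv Y x = fC' a x / (2 * Y x)"
    using abel_branchD(5) [OF br x] by (simp add: field_simps)
  with Y show ?thesis by simp
qed

lemma holo3_has_field_derivative_along_branch:
  assumes F: "holo3 F D" and D: "open D" "u \<in> D" and br: "abel_branch a U Y \<Phi>" "x \<in> U"
  shows "((\<lambda>t. F (u + (\<Phi> t - \<Phi> x))) has_field_derivative
    (\<Sum>k<3. pderiv3 F (Suc k) u * x ^ k) / Y x) (at x)"
proof -
  have "((\<lambda>t. u + (\<Phi> t - \<Phi> x)) has_derivative du x (Y x)) (at x)"
    using abel_branchD(6) [OF br] by (auto intro!: derivative_eq_intros)
  moreover have "(F has_derivative (\<lambda>(p, q, r). pderiv3 F 1 u * p + (pderiv3 F 2 u * q + pderiv3 F 3 u * r)))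
      (at (u + (\<Phi> x - \<Phi> x)))"
    using holo3_has_derivative [OF F D] by simp
  ultimately show ?thesis
    unfolding has_field_derivative_def
    by (rule has_derivative_eq_rhs [OF has_derivative_compose])
      (auto simp: du_def sum_lessThan_3 numeral_2_eq_2 [symmetric] numeral_3_eq_3 [symmetric] fun_eq_iff
        add_divide_distrib algebra_simps)
qed

locale wp_functions = octic_curve a for a +
  fixes wp :: "nat \<Rightarrow> nat \<Rightarrow> cvec3 \<Rightarrow> complex"
    and D :: "cvec3 set" and P :: "complex \<times> complex" and c :: cvec3
  assumes wp_sym: "wp_symmetric wp"
    and D_open: "open D"
    and holo: "\<And>i j. i \<in> {1,2,3} \<Longrightarrow> j \<in> {1,2,3} \<Longrightarrow> holo3 (wp i j) D"
    and hform_wp: "\<And>Z \<eta> v z w. abel_sum a P Z \<eta> v \<Longrightarrow> card Z = 4 \<Longrightarrow> c + v \<in> D \<Longrightarrow>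
      z \<in> Z \<Longrightarrow> w \<in> Z \<Longrightarrow> z \<noteq> w \<Longrightarrow> hform (hmat a (\<lambda>i j. wp i j (c + v))) z w = \<eta> z * \<eta> w"
begin

abbreviation wp_at :: "cvec3 \<Rightarrow> nat \<Rightarrow> nat \<Rightarrow> complex" where
  "wp_at u \<equiv> \<lambda>i j. wp i j u"

abbreviation dwp_at :: "cvec3 \<Rightarrow> nat \<Rightarrow> nat \<Rightarrow> nat \<Rightarrow> complex" where
  "dwp_at u \<equiv> \<lambda>i j k. pderiv3 (wp i j) k u"

lemma wp_at_symmetric: "wp_symmetric (wp_at u)"
  using wp_symmetricD [OF wp_sym] by (simp only: wp_symmetric_def) simp

lemma dwp_at_symmetric: "wp_symmetric (\<lambda>i j. dwp_at u i j k)"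
  using wp_symmetricD [OF wp_sym] by (simp only: wp_symmetric_def) simp

lemma wp_has_field_derivative_along_branch:
  assumes "u \<in> D" "abel_branch a U Y \<Phi>" "x \<in> U" "i \<in> {1,2,3}" "j \<in> {1,2,3}"
  shows "((\<lambda>t. wp_at (u + (\<Phi> t - \<Phi> x)) i j) has_field_derivative contract (dwp_at u) x i j / Y x) (at x)"
  unfolding contract_def
  by (rule holo3_has_field_derivative_along_branch [OF holo [OF assms(4,5)] D_open assms(1-3)])

lemma hform_moving_point:
  assumes Z: "card Z = 4" and sum: "abel_sum a P Z \<eta> v" and v: "c + v \<in> D"
    and x: "x \<in> Z" "Y x = \<eta> x" and br: "abel_branch a U Y \<Phi>" "x \<in> U"
  shows "\<forall>\<^sub>F t in nhds x.
    (\<forall>z\<in>Z - {x}. hform (hmat a (wp_at (c + v + (\<Phi> t - \<Phi> x)))) z t = \<eta> z * Y t \<and>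
      (\<forall>w\<in>Z - {x}. z \<noteq> w \<longrightarrow> hform (hmat a (wp_at (c + v + (\<Phi> t - \<Phi> x)))) z w = \<eta> z * \<eta> w))"
proof -
  have fin: "finite Z" using Z card.infinite by fastforce
  have "isCont (\<lambda>t. c + v + (\<Phi> t - \<Phi> x)) x"
    by (intro continuous_intros abel_branch_isCont [OF br])
  then have "((\<lambda>t. c + v + (\<Phi> t - \<Phi> x)) \<longlongrightarrow> c + v) (nhds x)"
    by (simp add: isCont_def tendsto_nhds_iff)
  then have "\<forall>\<^sub>F t in nhds x. c + v + (\<Phi> t - \<Phi> x) \<in> D"
    using D_open v by (rule topological_tendstoD)
  moreover have "\<forall>\<^sub>F t in nhds x. t \<in> U - (Z - {x})"
    using br(2) fin abel_branchD(1) [OF br(1)] by (intro eventually_nhds_in_open open_Diff finite_imp_closed) auto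
  ultimately show ?thesis
  proof eventually_elim
    case (elim t)
    let ?Z = "insert t (Z - {x})" and ?\<eta> = "\<eta>(t := Y t)"
    have "abel_sum a P ?Z ?\<eta> (v + (\<Phi> t - \<Phi> x))"
      using elim by (intro abel_sum_move_point [OF sum fin x _ br]) auto
    moreover have "card ?Z = 4"
      using elim card_insert_remove_other [OF fin x(1), of t] Z by simp
    moreover have "c + (v + (\<Phi> t - \<Phi> x)) \<in> D" using elim by (simp add: add.assoc)
    ultimately have pair: "hform (hmat a (wp_at (c + v + (\<Phi> t - \<Phi> x)))) z w = ?\<eta> z * ?\<eta> w"
      if "z \<in> ?Z" "w \<in> ?Z" "z \<noteq> w" for z w
      using hform_wp [OF _ _ _ that] by (simp only: add.assoc)
    have unchanged: "?\<eta> z = \<eta> z" "z \<noteq> t" if "z \<in> Z - {x}" for z using elim that by auto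
    show ?case
    proof (intro ballI conjI impI)
      fix z assume z: "z \<in> Z - {x}"
      show "hform (hmat a (wp_at (c + v + (\<Phi> t - \<Phi> x)))) z t = \<eta> z * Y t"
        using pair [of z t] unchanged [OF z] z by simp
      show "hform (hmat a (wp_at (c + v + (\<Phi> t - \<Phi> x)))) z w = \<eta> z * \<eta> w" if "w \<in> Z - {x}" "z \<noteq> w" for w
        using pair [of z w] unchanged [OF z] unchanged [OF that(1)] z that by simp
    qed
  qed
qed

end

locale wp_divisor = wp_functions a wp D P c + octic_pencil a L K "root_poly Z"
  for a wp D P c L K Z +
  fixes \<eta> :: "complex \<Rightarrow> complex" and v :: cvec3
  assumes sum: "abel_sum a P Z \<eta> v" and in_D: "c + v \<in> D" and L: "\<And>z. z \<in> Z \<Longrightarrow> poly L z = \<eta> z"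
begin

abbreviation W :: "complex poly" where
  "W \<equiv> root_poly Z"

lemma card_Z: "card Z = 4"
  using degree_W by simp

lemma W_eq_0: "z \<in> Z \<Longrightarrow> poly W z = 0"
  using card_Z card.infinite [of Z] by (cases "finite Z") (simp_all add: poly_root_poly_eq_0_iff)

lemma degrees: "degree L < 5" "degree K < 5" "degree W < 5"
  using degree_L degree_K degree_W by auto

lemma hmat_wp_eq_rank3_matrix: "i < 5 \<Longrightarrow> j < 5 \<Longrightarrow> hmat a (wp_at (c + v)) i j = rank3_matrix L K W i j"
proof (rule hmat_eq_rank3_matrix [OF wp_at_symmetric _ degrees card_Z W_eq_0])
  show "fC a x = (poly L x)\<^sup>2 + poly K x * poly W x" for x
    using arg_cong [OF factorization, of "\<lambda>p. poly p x"] by (simp add: poly_fpoly)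
  show "hform (hmat a (wp_at (c + v))) z w = poly L z * poly L w" if "z \<in> Z" "w \<in> Z" "z \<noteq> w" for z w
    using hform_wp [OF sum card_Z in_D that] L that by simp
qed

lemma hform_wp_eq: "z \<in> Z \<Longrightarrow> hform (hmat a (wp_at (c + v))) z t = \<eta> z * poly L t + poly K z * poly W t / 2"
proof -
  assume z: "z \<in> Z"
  have "hform (hmat a (wp_at (c + v))) z t = hform (rank3_matrix L K W) z t"
    unfolding hform_def using hmat_wp_eq_rank3_matrix by (intro sum.cong) auto
  then show ?thesis using hform_rank3_matrix [OF degrees] W_eq_0 [OF z] L [OF z] by simp
qed

lemma branch_at:
  assumes "x \<in> Z"
  obtains U Y \<Phi> where "abel_branch a U Y \<Phi>" "x \<in> U" "Y x = \<eta> x"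
proof -
  have "(\<eta> x)\<^sup>2 = fC a x" "\<eta> x \<noteq> 0" using abel_sum_on_curve [OF sum assms] by auto
  then obtain r Y \<Phi> where "r > 0" "abel_branch a (ball x r) Y \<Phi>" "Y x = \<eta> x"
    by (rule abel_branch_exists)
  then show thesis using that [of "ball x r" Y \<Phi>] by simp
qed

lemma hform_wp_increment_has_field_derivative:
  assumes "abel_branch a U Y \<Phi>" "x \<in> U" and m: "(m has_field_derivative m') (at x)"
  shows "((\<lambda>t. hform (hmat a (wp_at (c + v + (\<Phi> t - \<Phi> x)))) z (m t) - hform (hmat a (wp_at (c + v))) z (m t))
    has_field_derivative - 2 * (z - m x)\<^sup>2 * (wp_form (contract (dwp_at (c + v)) x) z (m x) / Y x)) (at x)"
  using hform_increment_has_field_derivative [OF wp_has_field_derivative_along_branch [OF in_D assms(1,2)]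
      wp_at_symmetric m, of a z]
  by (simp add: wp_form_divide)

lemma dwp_form_fixed_points:
  assumes x: "x \<in> Z" and zw: "z \<in> Z - {x}" "w \<in> Z - {x}" "z \<noteq> w"
  shows "wp_form (contract (dwp_at (c + v)) x) z w = 0"
proof -
  obtain U Y \<Phi> where br: "abel_branch a U Y \<Phi>" "x \<in> U" and Y: "Y x = \<eta> x"
    using branch_at [OF x] .
  let ?h = "\<lambda>t. hform (hmat a (wp_at (c + v + (\<Phi> t - \<Phi> x)))) z w"
  have "\<forall>\<^sub>F t in nhds x. ?h t - hform (hmat a (wp_at (c + v))) z w = 0"
    using hform_moving_point [OF card_Z sum in_D x Y br]
  proof eventually_elim
    case (elim t)
    then show ?case using hform_wp [OF sum card_Z in_D, of z w] zw by auto
  qed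
  then have "((\<lambda>t. ?h t - hform (hmat a (wp_at (c + v))) z w) has_field_derivative 0) (at x)"
    by (rule DERIV_cong_ev [OF refl _ refl, THEN iffD2, OF _ DERIV_const])
  from DERIV_unique [OF hform_wp_increment_has_field_derivative [OF br DERIV_const] this]
  show ?thesis using zw(3) abel_branchD(5) [OF br] by simp
qed

lemma dwp_form_moving_point:
  assumes x: "x \<in> Z" and z: "z \<in> Z - {x}"
  shows "4 * (z - x)\<^sup>2 * wp_form (contract (dwp_at (c + v)) x) z x =
    poly (pderiv W) x * (poly K z * poly L x - poly L z * poly K x)"
proof -
  obtain U Y \<Phi> where br: "abel_branch a U Y \<Phi>" "x \<in> U" and Y: "Y x = \<eta> x"
    using branch_at [OF x] .
  define b where "b = wp_form (contract (dwp_at (c + v)) x) z x"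
  let ?h = "\<lambda>t. hform (hmat a (wp_at (c + v + (\<Phi> t - \<Phi> x)))) z t"
  let ?g = "\<lambda>t. \<eta> z * Y t - (\<eta> z * poly L t + poly K z * poly W t / 2)"
  have "\<forall>\<^sub>F t in nhds x. ?h t - hform (hmat a (wp_at (c + v))) z t = ?g t"
    using hform_moving_point [OF card_Z sum in_D x Y br]
  proof eventually_elim
    case (elim t)
    then show ?case using hform_wp_eq [of z t] z by auto
  qed
  then have "(?g has_field_derivative - 2 * (z - x)\<^sup>2 * (b / Y x)) (at x)"
    using hform_wp_increment_has_field_derivative [OF br DERIV_ident, of z]
    by (subst DERIV_cong_ev [OF refl _ refl, symmetric]) (auto simp: b_def)
  moreover have "(?g has_field_derivative \<eta> z * (fC' a x / (2 * Y x))
      - (\<eta> z * poly (pderiv L) x + poly K z * poly (pderiv W) x / 2)) (at x)"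
    by (intro DERIV_diff DERIV_add DERIV_cmult DERIV_cdivide poly_DERIV
        abel_branch_ordinate_has_field_derivative [OF br])
  ultimately have "- 2 * (z - x)\<^sup>2 * (b / Y x) = \<eta> z * (fC' a x / (2 * Y x))
      - (\<eta> z * poly (pderiv L) x + poly K z * poly (pderiv W) x / 2)"
    by (rule DERIV_unique)
  moreover have "fC' a x = 2 * Y x * poly (pderiv L) x + poly K x * poly (pderiv W) x"
    using arg_cong [OF factorization, of "\<lambda>p. poly (pderiv p) x"] W_eq_0 [OF x] L [OF x] Y
    by (simp add: poly_pderiv_fpoly pderiv_add pderiv_mult power2_eq_square algebra_simps)
  ultimately show ?thesis
    using abel_branchD(5) [OF br] L [OF x] L [of z] z Y unfolding b_def [symmetric]
    by (simp add: field_simps) algebra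
qed

lemma hmat_Amat_at_divisor:
  assumes "i < 5" "k < 5"
  shows "(\<Sum>j<5. hmat a (wp_at (c + v)) i j * Amat (dwp_at (c + v)) j k) = 0"
  using hmat_wp_eq_rank3_matrix
    eq_schur_tensorI [OF degrees card_Z W_eq_0 dwp_at_symmetric dwp_form_fixed_points dwp_form_moving_point] assms
  by (rule hmat_Amat_eq_0)

end

context wp_functions
begin

lemma hmat_Amat_at_abel_sum:
  assumes "v \<in> abel_sums a P 4" and in_D: "c + v \<in> D" and ik: "i < 5" "k < 5"
  shows "(\<Sum>j<5. hmat a (wp_at (c + v)) i j * Amat (dwp_at (c + v)) j k) = 0"
proof -
  obtain Z \<eta> where Z: "card Z = 4" and sum: "abel_sum a P Z \<eta> v"
    using assms(1) unfolding abel_sums_def by blast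
  obtain L K where pencil: "octic_pencil a L K (root_poly Z)" and L: "\<forall>z\<in>Z. poly L z = \<eta> z"
    using octic_pencil_through [OF Z, of \<eta>] abel_sum_on_curve [OF sum] by blast
  interpret octic_pencil a L K "root_poly Z" by (rule pencil)
  interpret wp_divisor a wp D P c L K Z \<eta> v
    using sum in_D L by unfold_locales auto
  show ?thesis using ik by (rule hmat_Amat_at_divisor)
qed

lemma hmat_Amat_on_domain:
  assumes base: "P = (x0, y0)" "y0\<^sup>2 = fC a x0" "y0 \<noteq> 0" and u: "u \<in> D" and ik: "i < 5" "k < 5"
  shows "(\<Sum>j<5. hmat a (wp_at u) i j * Amat (dwp_at u) j k) = 0"
proof (rule continuous_on_open_eq_0_if_dense [OF _ D_open _ _ u])
  show "continuous_on D (\<lambda>u. \<Sum>j<5. hmat a (wp_at u) i j * Amat (dwp_at u) j k)"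
    using ik holo by (intro continuous_on_sum continuous_on_mult continuous_on_hmat continuous_on_Amat
        continuous_on_pderiv3 [OF holo D_open]) (auto simp: holo3_def)
  show "closure ((\<lambda>v. c + v) ` abel_sums a P 4) = UNIV"
    using closure_abel_sums [OF base(2,3)] surj_plus [of c] by (simp add: closure_translation base(1))
  show "(\<Sum>j<5. hmat a (wp_at u) i j * Amat (dwp_at u) j k) = 0" if "u \<in> (\<lambda>v. c + v) ` abel_sums a P 4 \<inter> D" for u
    using that hmat_Amat_at_abel_sum [OF _ _ ik] by auto
qed

end

lemma add3_eq_plus: "add3 u v = u + v"
  by (simp add: add3_def plus_prod_def)

lemma abel_sum_four_pathsE:
  assumes sum: "abel_sum a P Z \<eta> v" and Z: "card Z = 4" and zw: "z \<in> Z" "w \<in> Z" "z \<noteq> w"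
  obtains x2 y2 x3 y3 gx gy gx1 gy1 gx2 gy2 gx3 gy3
  where "curve_path a gx gy P (z, \<eta> z)" "curve_path a gx1 gy1 P (w, \<eta> w)"
    "curve_path a gx2 gy2 P (x2, y2)" "curve_path a gx3 gy3 P (x3, y3)"
    "v = add3 (abel gx gy) (add3 (abel gx1 gy1) (add3 (abel gx2 gy2) (abel gx3 gy3)))"
proof -
  have fin: "finite Z" using Z card.infinite by fastforce
  have "card (Z - {z} - {w}) = 2" using Z zw fin by simp
  then obtain s t where st: "Z - {z} - {w} = {s, t}" "s \<noteq> t" by (auto simp: card_2_iff)
  then have Z_eq: "Z = {z, w, s, t}" "z \<noteq> s" "z \<noteq> t" "w \<noteq> s" "w \<noteq> t" using zw by blast+
  obtain V where V: "\<And>x. x \<in> Z \<Longrightarrow> abel_value a P (x, \<eta> x) (V x)" and v: "v = (\<Sum>x\<in>Z. V x)"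
    using sum unfolding abel_sum_def by blast
  have "\<exists>gx gy. curve_path a gx gy P (x, \<eta> x) \<and> abel gx gy = V x" if "x \<in> Z" for x
    using abel_valueE [OF V [OF that]] by metis
  then obtain gx gy where g: "\<And>x. x \<in> Z \<Longrightarrow> curve_path a (gx x) (gy x) P (x, \<eta> x)"
      "\<And>x. x \<in> Z \<Longrightarrow> abel (gx x) (gy x) = V x"
    by metis
  have "v = V z + (V w + (V s + V t))"
    using v zw(3) Z_eq(2-) st(2) unfolding Z_eq(1) by simp
  then have "v = add3 (abel (gx z) (gy z)) (add3 (abel (gx w) (gy w)) (add3 (abel (gx s) (gy s)) (abel (gx t) (gy t))))"
    using g(2) by (simp add: Z_eq(1) add3_eq_plus)
  then show thesis
    using that [OF g(1) [of z] g(1) [of w] g(1) [of s] g(1) [of t]] by (simp add: Z_eq(1))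
qed

theorem mainTheorem6:
  fixes a :: "nat \<Rightarrow> complex"
    and wp :: "nat \<Rightarrow> nat \<Rightarrow> cvec3 \<Rightarrow> complex"
    and D :: "cvec3 set"
    and x0 y0 :: complex
    and c :: cvec3
  assumes deg: "a 8 \<noteq> 0"
    and nonsing: "\<And>x. fC a x = 0 \<Longrightarrow> fC' a x \<noteq> 0"
    and sym: "\<And>i j. i \<in> {1,2,3} \<Longrightarrow> j \<in> {1,2,3} \<Longrightarrow> wp i j = wp j i"
    and D_open: "open D"
    and holo: "\<And>i j. i \<in> {1,2,3} \<Longrightarrow> j \<in> {1,2,3} \<Longrightarrow> holo3 (wp i j) D"
    and base: "y0\<^sup>2 = fC a x0" "y0 \<noteq> 0"
    and defining:
      "\<And>x y x1 y1 x2 y2 x3 y3 gx gy gx1 gy1 gx2 gy2 gx3 gy3 u.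
         curve_path a gx gy (x0, y0) (x, y) \<Longrightarrow>
         curve_path a gx1 gy1 (x0, y0) (x1, y1) \<Longrightarrow>
         curve_path a gx2 gy2 (x0, y0) (x2, y2) \<Longrightarrow>
         curve_path a gx3 gy3 (x0, y0) (x3, y3) \<Longrightarrow>
         u = add3 c (add3 (abel gx gy) (add3 (abel gx1 gy1) (add3 (abel gx2 gy2) (abel gx3 gy3)))) \<Longrightarrow>
         u \<in> D \<Longrightarrow>
         y * y1 - hform (hmat a (\<lambda>i j. wp i j u)) x x1 = 0 \<and>
         y * y2 - hform (hmat a (\<lambda>i j. wp i j u)) x x2 = 0 \<and>
         y * y3 - hform (hmat a (\<lambda>i j. wp i j u)) x x3 = 0"
  shows "\<forall>u\<in>D. \<forall>i<5. \<forall>k<5.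
           (\<Sum>j<5. hmat a (\<lambda>p q. wp p q u) i j *
                    Amat (\<lambda>p q r. pderiv3 (wp p q) r u) j k) = 0"
proof -
  interpret wp_functions a wp D "(x0, y0)" c
  proof
    show "wp_symmetric wp" unfolding wp_symmetric_def using sym by blast
    fix Z \<eta> v z w
    assume "abel_sum a (x0, y0) Z \<eta> v" "card Z = 4" "z \<in> Z" "w \<in> Z" "z \<noteq> w" and in_D: "c + v \<in> D"
    then obtain x2 y2 x3 y3 gx gy gx1 gy1 gx2 gy2 gx3 gy3
      where "curve_path a gx gy (x0, y0) (z, \<eta> z)" "curve_path a gx1 gy1 (x0, y0) (w, \<eta> w)"
        "curve_path a gx2 gy2 (x0, y0) (x2, y2)" "curve_path a gx3 gy3 (x0, y0) (x3, y3)"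
        "v = add3 (abel gx gy) (add3 (abel gx1 gy1) (add3 (abel gx2 gy2) (abel gx3 gy3)))"
      by (elim abel_sum_four_pathsE)
    then show "hform (hmat a (\<lambda>i j. wp i j (c + v))) z w = \<eta> z * \<eta> w"
      using defining [of gx gy z "\<eta> z" gx1 gy1 w "\<eta> w" gx2 gy2 x2 y2 gx3 gy3 x3 y3 "c + v"] in_D
      by (simp add: add3_eq_plus)
  qed (fact deg nonsing D_open holo)+
  show ?thesis using hmat_Amat_on_domain [OF refl base] by blast
qed

end
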